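(* Consider the following pricing model for a reusable resource. A firm owns $C\in\mathbb{Z}_{>0}$ identical units. Customers arrive according to a Poisson process of rate $\Lambda>0$ with i.i.d. willingness-to-pay with distribution $F$; a customer arriving when the posted price is $p$ purchases if and only if a unit is available and their willingness-to-pay exceeds $p$, so the effective arrival rate at price $p$ is $\lambda(p)=\Lambda\bar F(p)$. Assume $\lambda(\cdot)$ is a bijection onto $[0,\Lambda]$ with inverse $p(\lambda)$, and that $\lambda\mapsto\lambda(p(\lambda)-c)$ is concave, where $c>0$ is the cost per customer served. A purchasing customer pays $p$ and occupies one unit for an exponentially distributed time with mean $1/\mu$ ($\mu>0$), i.i.d. across customers and independent of valuations; after that the unit is available again. Customers arriving when all units are occupied are lost. A policy $\pi$ chooses, in a non-anticipating way, an effective arrival rate $\lambda(t)\in[0,\Lambda]$ (equivalently the price $p(\lambda(t))$); a static policy uses one constant rate at all times. Let $Q^\pi(t)$ be the number of available units and $N^\pi(t)$ the arrival counting process (intensity $\lambda(t)$). Define the long-run profit rate $R^\pi=\liminf_{T\to\infty}\frac1T\mathbb{E}\big[\int_0^T\mathbf 1\{Q^\pi(t)>0\}(p(\lambda(t))-c)\,dN^\pi(t)\big]$, the market share $M^\pi$ as the long-run average number of units sold per unit time, $M^\pi=\liminf_{T\to\infty}\frac1T\mathbb{E}\big[\int_0^T\mathbf 1\{Q^\pi(t)>0\}\,dN^\pi(t)\big]$, and the service level $A^\pi=\liminf_{T\to\infty}\frac1T\mathbb{E}\big[\int_0^T\mathbf 1\{Q^\pi(t)>0\}\,dt\big]$.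 Fix weights $\alpha_1,\alpha_2,\alpha_3\ge0$ with $\alpha_1+\alpha_2+\alpha_3=1$, and let $\pi^*$ be an optimal dynamic policy, i.e. one maximizing $\alpha_1R^\pi+\alpha_2M^\pi+\alpha_3A^\pi$ over all non-anticipating policies. Then for every such instance (any $C$, $\mu$, $c$, $p(\cdot)$, weights) there exists a static pricing policy $\pi^s$ with $$\min\left\{\frac{R^{\pi^s}}{R^{\pi^*}},\frac{M^{\pi^s}}{M^{\pi^*}},\frac{A^{\pi^s}}{A^{\pi^*}}\right\}\ge\frac{15}{19}.$$
   Context: All model definitions are given in the statement. "Non-anticipating" means the rate at time $t$ depends only on the history up to $t^-$.
   Formalization: The bound on the minimum of the three ratios is stated when R, M and A of the optimal policy are positive (ratios may be undefined or the claim false otherwise); in all cases the static policy satisfies X(static) ≥ (15/19)·X(optimal) for X = R, M, A. *)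

theory Defs
  imports "HOL-Probability.Probability"
begin

(* Demand. F is the law of the willingness-to-pay and P the set of admissible prices, on which the
   effective rate is required to be a bijection onto the interval from 0 to \<Lambda>. *)

definition effective_rate :: "real \<Rightarrow> real measure \<Rightarrow> real \<Rightarrow> real" where
  "effective_rate \<Lambda> F x = \<Lambda> * measure F {x<..}"

definition price :: "real \<Rightarrow> real measure \<Rightarrow> real set \<Rightarrow> real \<Rightarrow> real" where
  "price \<Lambda> F P = the_inv_into P (effective_rate \<Lambda> F)"

(* Primitive randomness: for the n-th arriving customer the triple (time since the previous arrival,
   willingness-to-pay, service time). The triples are i.i.d. with independent components, and the
   exponential interarrival times make the arrivals a Poisson process of rate \<Lambda>. The service time of a
   customer who does not purchase is never used. *)

type_synonym sample = "nat \<Rightarrow> real \<times> real \<times> real"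

definition primitives :: "real \<Rightarrow> real \<Rightarrow> real measure \<Rightarrow> sample measure" where
  "primitives \<Lambda> \<mu> F = Pi\<^sub>M UNIV (\<lambda>_::nat.
     density lborel (exponential_density \<Lambda>) \<Otimes>\<^sub>M F \<Otimes>\<^sub>M density lborel (exponential_density \<mu>))"

definition arrival_time :: "sample \<Rightarrow> nat \<Rightarrow> real" where
  "arrival_time \<omega> n = (\<Sum>i\<le>n. fst (\<omega> i))"

definition wtp :: "sample \<Rightarrow> nat \<Rightarrow> real" where
  "wtp \<omega> n = fst (snd (\<omega> n))"

definition service_time :: "sample \<Rightarrow> nat \<Rightarrow> real" where
  "service_time \<omega> n = snd (snd (\<omega> n))"

(* Record of a customer: (arrival time, willingness-to-pay, received a unit?, departure time).
   A customer who does not receive a unit departs upon arrival. *)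

type_synonym customer = "real \<times> real \<times> bool \<times> real"

type_synonym history = "nat \<Rightarrow> customer"

definition history_space :: "history measure" where
  "history_space = Pi\<^sub>M UNIV (\<lambda>_::nat. borel \<Otimes>\<^sub>M borel \<Otimes>\<^sub>M count_space UNIV \<Otimes>\<^sub>M borel)"

(* What has been observed strictly before time t: customers who have not arrived yet are replaced by a
   dummy record, and departure times are censored at t. *)

definition history_before :: "real \<Rightarrow> history \<Rightarrow> history" where
  "history_before t d = (\<lambda>n. case d n of (a, w, b, e) \<Rightarrow>
     if a < t then (a, w, b, min e t) else (t, 0, False, t))"

(* The number Q(t-) of available units just before t. The left-continuous version is the one that an
   arrival at time t finds; it differs from Q(t) at the jump times only. *)

definition available :: "nat \<Rightarrow> history \<Rightarrow> real \<Rightarrow> nat" where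
  "available C d t = C - card {n. case d n of (a, w, b, e) \<Rightarrow> b \<and> a < t \<and> t \<le> e}"

(* A policy maps the time t and the history before t to an effective arrival rate. Joint measurability
   makes the resulting rate process predictable. *)

type_synonym policy = "real \<Rightarrow> history \<Rightarrow> real"

definition admissible :: "real \<Rightarrow> policy \<Rightarrow> bool" where
  "admissible \<Lambda> \<pi> \<longleftrightarrow>
     (\<lambda>(t, h). \<pi> t h) \<in> borel_measurable (borel \<Otimes>\<^sub>M history_space) \<and> (\<forall>t h. \<pi> t h \<in> {0..\<Lambda>})"

definition static_policy :: "real \<Rightarrow> policy \<Rightarrow> bool" where
  "static_policy \<Lambda> \<pi> \<longleftrightarrow> (\<exists>l\<in>{0..\<Lambda>}. \<pi> = (\<lambda>t h. l))"

(* The rate \<lambda>(t) along a trajectory d. *)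

definition rate :: "policy \<Rightarrow> history \<Rightarrow> real \<Rightarrow> real" where
  "rate \<pi> d t = \<pi> t (history_before t d)"

(* Dynamics under the price function p, starting with all C units available. In stage n the records of
   the customers k < n are final. Customers k \<ge> n have not arrived before the n-th arrival time, so that
   their provisional records affect neither the rate nor the availability found by customer n. *)

primrec customers :: "nat \<Rightarrow> (real \<Rightarrow> real) \<Rightarrow> policy \<Rightarrow> sample \<Rightarrow> nat \<Rightarrow> history" where
  "customers C p \<pi> \<omega> 0 = (\<lambda>k. (arrival_time \<omega> k, wtp \<omega> k, False, arrival_time \<omega> k))"
| "customers C p \<pi> \<omega> (Suc n) =
     (let d = customers C p \<pi> \<omega> n;
          t = arrival_time \<omega> n;
          b = (0 < available C d t \<and> p (rate \<pi> d t) < wtp \<omega> n)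
      in d(n := (t, wtp \<omega> n, b, if b then t + service_time \<omega> n else t)))"

definition trajectory :: "nat \<Rightarrow> (real \<Rightarrow> real) \<Rightarrow> policy \<Rightarrow> sample \<Rightarrow> history" where
  "trajectory C p \<pi> \<omega> = (\<lambda>n. customers C p \<pi> \<omega> (Suc n) n)"

(* Q(t-) and \<lambda>(t) under policy \<pi>. *)

definition Q :: "nat \<Rightarrow> (real \<Rightarrow> real) \<Rightarrow> policy \<Rightarrow> sample \<Rightarrow> real \<Rightarrow> nat" where
  "Q C p \<pi> \<omega> t = available C (trajectory C p \<pi> \<omega>) t"

definition rate_process :: "nat \<Rightarrow> (real \<Rightarrow> real) \<Rightarrow> policy \<Rightarrow> sample \<Rightarrow> real \<Rightarrow> real" where
  "rate_process C p \<pi> \<omega> t = rate \<pi> (trajectory C p \<pi> \<omega>) t"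

(* The integral of f over [0, T] with respect to the counting process N of the customers whose
   willingness-to-pay exceeds the price posted at their arrival, whether or not a unit is available. *)

definition integral_dN ::
    "nat \<Rightarrow> (real \<Rightarrow> real) \<Rightarrow> policy \<Rightarrow> sample \<Rightarrow> real \<Rightarrow> (real \<Rightarrow> real) \<Rightarrow> real" where
  "integral_dN C p \<pi> \<omega> T f =
     (\<Sum>n | arrival_time \<omega> n \<le> T \<and> p (rate_process C p \<pi> \<omega> (arrival_time \<omega> n)) < wtp \<omega> n.
        f (arrival_time \<omega> n))"

definition profit_rate ::
    "nat \<Rightarrow> real \<Rightarrow> real \<Rightarrow> real \<Rightarrow> real measure \<Rightarrow> real set \<Rightarrow> policy \<Rightarrow> ereal" where
  "profit_rate C \<Lambda> \<mu> c F P \<pi> = (let p = price \<Lambda> F P in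
     Liminf at_top (\<lambda>T::real. ereal (1 / T * (\<integral>\<omega>.
       integral_dN C p \<pi> \<omega> T (\<lambda>t. of_bool (Q C p \<pi> \<omega> t > 0) * (p (rate_process C p \<pi> \<omega> t) - c))
       \<partial>primitives \<Lambda> \<mu> F))))"

definition market_share ::
    "nat \<Rightarrow> real \<Rightarrow> real \<Rightarrow> real measure \<Rightarrow> real set \<Rightarrow> policy \<Rightarrow> ereal" where
  "market_share C \<Lambda> \<mu> F P \<pi> = (let p = price \<Lambda> F P in
     Liminf at_top (\<lambda>T::real. ereal (1 / T * (\<integral>\<omega>.
       integral_dN C p \<pi> \<omega> T (\<lambda>t. of_bool (Q C p \<pi> \<omega> t > 0)) \<partial>primitives \<Lambda> \<mu> F))))"

definition service_level ::
    "nat \<Rightarrow> real \<Rightarrow> real \<Rightarrow> real measure \<Rightarrow> real set \<Rightarrow> policy \<Rightarrow> ereal" where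
  "service_level C \<Lambda> \<mu> F P \<pi> = (let p = price \<Lambda> F P in
     Liminf at_top (\<lambda>T::real. ereal (1 / T * (\<integral>\<omega>.
       (LINT t:{0..T}|lborel. of_bool (Q C p \<pi> \<omega> t > 0)) \<partial>primitives \<Lambda> \<mu> F))))"

definition objective ::
    "nat \<Rightarrow> real \<Rightarrow> real \<Rightarrow> real \<Rightarrow> real measure \<Rightarrow> real set \<Rightarrow> real \<Rightarrow> real \<Rightarrow> real \<Rightarrow> policy \<Rightarrow> ereal" where
  "objective C \<Lambda> \<mu> c F P \<alpha>1 \<alpha>2 \<alpha>3 \<pi> =
     ereal \<alpha>1 * profit_rate C \<Lambda> \<mu> c F P \<pi> + ereal \<alpha>2 * market_share C \<Lambda> \<mu> F P \<pi>
       + ereal \<alpha>3 * service_level C \<Lambda> \<mu> F P \<pi>"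

definition optimal_policy ::
    "nat \<Rightarrow> real \<Rightarrow> real \<Rightarrow> real \<Rightarrow> real measure \<Rightarrow> real set \<Rightarrow> real \<Rightarrow> real \<Rightarrow> real \<Rightarrow> policy \<Rightarrow> bool" where
  "optimal_policy C \<Lambda> \<mu> c F P \<alpha>1 \<alpha>2 \<alpha>3 \<pi> \<longleftrightarrow> admissible \<Lambda> \<pi> \<and>
     (\<forall>\<pi>'. admissible \<Lambda> \<pi>' \<longrightarrow>
        objective C \<Lambda> \<mu> c F P \<alpha>1 \<alpha>2 \<alpha>3 \<pi>' \<le> objective C \<Lambda> \<mu> c F P \<alpha>1 \<alpha>2 \<alpha>3 \<pi>)"

end

(* Along every trajectory the number of upward crossings from i to i + 1 occupied units exceeds the number
   of downward crossings by 0 or 1. Interarrival and service times are exponential, so in expectation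
   these numbers are the time integrals of lambda(t) 1{i occupied} and of (i + 1) mu 1{i + 1 occupied}.
   Hence the long-run occupation frequencies q_i satisfy 0 <= (i + 1) mu q_(i+1) <= Lambda q_i along a
   subsequence, with the equality (i + 1) mu q_(i+1) = l q_i under a static rate l, which gives Erlang's
   formula.

   For an arbitrary policy let a be the limiting service level and m the limiting market share. Little's
   law m / mu <= C - a gives a <= min (1, C / (1 + rho)) with rho = m / (a mu). The idle probability A of
   Erlang's formula is decreasing in the load and (1 + x) A x is increasing, so A rho >= 15/19 a follows
   from its value at rho = C - 1, which is smallest for C = 3. The static rate l with throughput 15/19 m
   is then at most m / a, hence its price is at least the average price of the policy by concavity of
   the profit function. This proves all three inequalities. *)

theory Submission
  imports Defs
begin

subsection \<open>Exponential clocks and resampling of one customer\<close>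

text \<open>A policy may depend on the whole history and on the time, so no Markov chain is
  available, and the three limits inferior may be approached along different times. As a limit
  inferior is at most every subsequential limit, one subsequence along which all occupancies
  converge bounds the three measures together; profit, which need not converge there, is dominated
  by an affine function of service level and market share. The expected numbers of crossings come
  from redrawing the triple of a single customer: until its clock rings the path does not depend on
  that clock, so the value at the ring has the same mean as the integral of this value against the
  hazard rate. The constant is the idle probability for C = 3 at load 2: (1 + 2 + 2) / (1 + 2 + 2 +
  4/3) = 15/19. The static rate matches the throughput 15/19 m exactly instead of using the mean
  rate m / a: the margin at m / a may be negative, and then every sale beyond 15/19 m adds to the
  loss. With the throughput fixed, the profit inequality compares only margins per sale, of either
  sign.\<close>

abbreviation exp_dist :: "real \<Rightarrow> real measure" where
  "exp_dist l \<equiv> density lborel (\<lambda>x. ennreal (exponential_density l x))"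

lemma emeasure_exp_dist_atLeast:
  assumes l: "0 < l" and u: "0 \<le> u"
  shows "emeasure (exp_dist l) {u..} = ennreal (exp (- l * u))"
proof -
  interpret prob_space "exp_dist l" by (rule prob_space_exponential_density[OF l])
  have "emeasure (exp_dist l) {u..} = (\<integral>\<^sup>+x. ennreal (exponential_density l x) * indicator {u..} x \<partial>lborel)"
    by (simp add: emeasure_density)
  also have "\<dots> = (\<integral>\<^sup>+x. ennreal (exponential_density l x) * indicator {u<..} x \<partial>lborel)"
    by (rule nn_integral_cong_AE)
       (use AE_lborel_singleton[of u] in \<open>auto elim!: eventually_mono split: split_indicator\<close>)
  also have "\<dots> = emeasure (exp_dist l) (space (exp_dist l) - {..u})"
    by (subst emeasure_density) (auto intro!: nn_integral_cong split: split_indicator)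
  also have "\<dots> = 1 - ennreal (erlang_CDF 0 l u)"
    by (subst emeasure_compl) (auto simp: emeasure_erlang_density[OF l] emeasure_space_1[simplified])
  also have "\<dots> = ennreal (1 - erlang_CDF 0 l u)"
    using l by (simp flip: ennreal_1 add: ennreal_minus)
  also have "1 - erlang_CDF 0 l u = exp (- l * u)"
    using u by (simp add: erlang_CDF_def)
  finally show ?thesis .
qed

text \<open>The density at u is l times the probability of surviving until u. After Fubini this
  trades the value at the ringing time for a time integral up to that time, which is the compensator
  of a single jump.\<close>

lemma exponential_clock:
  fixes \<psi> :: "real \<Rightarrow> ennreal"
  assumes l: "0 < l" and [measurable]: "\<psi> \<in> borel_measurable borel"
  shows "(\<integral>\<^sup>+s. \<psi> s \<partial>exp_dist l)
    = (\<integral>\<^sup>+s. (\<integral>\<^sup>+u. ennreal l * \<psi> u * indicator {0<..s} u \<partial>lborel) \<partial>exp_dist l)"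
proof -
  interpret prob_space "exp_dist l" by (rule prob_space_exponential_density[OF l])
  interpret pair_sigma_finite lborel "exp_dist l" ..
  have [measurable]: "(\<lambda>x. indicator {0<..snd x} (fst x)) \<in> borel_measurable (lborel \<Otimes>\<^sub>M exp_dist l)"
    unfolding greaterThanAtMost_def by (simp add: indicator_def) measurable
  have "(\<integral>\<^sup>+s. (\<integral>\<^sup>+u. ennreal l * \<psi> u * indicator {0<..s} u \<partial>lborel) \<partial>exp_dist l)
      = (\<integral>\<^sup>+u. (\<integral>\<^sup>+s. ennreal l * \<psi> u * indicator {0<..s} u \<partial>exp_dist l) \<partial>lborel)"
    by (rule Fubini'[of "\<lambda>u s. ennreal l * \<psi> u * indicator {0<..s} u"]) (simp add: split_beta)
  \<comment> \<open>The point 0 is set aside: the density equals l there, but the interval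
    \<open>{0<..s}\<close> omits it.\<close>
  also have "\<dots> = (\<integral>\<^sup>+u. ennreal (exponential_density l u) * \<psi> u \<partial>lborel)"
  proof (rule nn_integral_cong_AE, use AE_lborel_singleton[of 0] in eventually_elim)
    case (elim u)
    have "(\<integral>\<^sup>+s. ennreal l * \<psi> u * indicator {0<..s} u \<partial>exp_dist l)
        = (\<integral>\<^sup>+s. (ennreal l * \<psi> u * indicator {0<..} u) * indicator {u..} s \<partial>exp_dist l)"
      by (intro nn_integral_cong) (auto split: split_indicator)
    also have "\<dots> = ennreal l * \<psi> u * indicator {0<..} u * emeasure (exp_dist l) {u..}"
      by (subst nn_integral_cmult_indicator) auto
    also have "\<dots> = ennreal (exponential_density l u) * \<psi> u"
    proof (cases "0 < u")
      case True
      then have "ennreal (exponential_density l u) = ennreal l * ennreal (exp (- l * u))"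
        using l by (subst ennreal_mult[symmetric]) (auto simp: exponential_density_def mult.commute)
      then show ?thesis using True l
        by (simp add: emeasure_exp_dist_atLeast[OF l] mult_ac)
    next
      case False
      with elim show ?thesis by (simp add: exponential_density_def)
    qed
    finally show ?case .
  qed
  also have "\<dots> = (\<integral>\<^sup>+s. \<psi> s \<partial>exp_dist l)"
    by (simp add: nn_integral_density)
  finally show ?thesis by simp
qed

lemma AE_exp_dist_pos:
  assumes "0 < l"
  shows "AE x in exp_dist l. 0 < x"
  by (subst AE_density)
     (use AE_lborel_singleton[of 0] in \<open>auto elim!: eventually_mono simp: exponential_density_def split: if_splits\<close>)

lemma AE_exp_dist_neq: "AE x in exp_dist l. x \<noteq> a"
  by (subst AE_density) (use AE_lborel_singleton[of a] in \<open>auto elim!: eventually_mono\<close>)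

context
  fixes \<Lambda> \<mu> :: real and F :: "real measure"
  assumes \<Lambda>: "0 < \<Lambda>" and \<mu>: "0 < \<mu>" and F: "real_distribution F"
begin

interpretation F: real_distribution F by (fact F)

lemma sets_primitives [measurable_cong]:
  "sets (primitives \<Lambda> \<mu> F) = sets (Pi\<^sub>M UNIV (\<lambda>_::nat. borel \<Otimes>\<^sub>M borel \<Otimes>\<^sub>M borel))"
  unfolding primitives_def by (intro sets_PiM_cong refl sets_pair_measure_cong) auto

lemma space_primitives [simp]: "space (primitives \<Lambda> \<mu> F) = UNIV"
  unfolding sets_eq_imp_space_eq[OF sets_primitives] by (simp add: space_PiM space_pair_measure)

lemma prob_space_primitives: "prob_space (primitives \<Lambda> \<mu> F)"
  unfolding primitives_def
  by (intro prob_space_PiM prob_space_pair prob_space_exponential_density \<Lambda> \<mu> F.prob_space_axioms)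

text \<open>Replacing one coordinate by an independent copy preserves a product law. The iterated
  form lets the interarrival time, the valuation and the service time of customer n be integrated
  one at a time while all other customers stay fixed.\<close>

lemma resample:
  fixes f :: "sample \<Rightarrow> ennreal"
  assumes f[measurable]: "f \<in> borel_measurable (primitives \<Lambda> \<mu> F)"
  shows "(\<integral>\<^sup>+\<xi>. f \<xi> \<partial>primitives \<Lambda> \<mu> F)
    = (\<integral>\<^sup>+\<xi>. (\<integral>\<^sup>+u. (\<integral>\<^sup>+w. (\<integral>\<^sup>+s. f (\<xi>(n := (u, w, s))) \<partial>exp_dist \<mu>) \<partial>F) \<partial>exp_dist \<Lambda>) \<partial>primitives \<Lambda> \<mu> F)"
proof -
  let ?P = "primitives \<Lambda> \<mu> F" let ?N = "exp_dist \<Lambda> \<Otimes>\<^sub>M F \<Otimes>\<^sub>M exp_dist \<mu>"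
  interpret E1: prob_space "exp_dist \<Lambda>" by (rule prob_space_exponential_density[OF \<Lambda>])
  interpret E2: prob_space "exp_dist \<mu>" by (rule prob_space_exponential_density[OF \<mu>])
  interpret FE: pair_prob_space F "exp_dist \<mu>" ..
  interpret EFE: pair_prob_space "exp_dist \<Lambda>" "F \<Otimes>\<^sub>M exp_dist \<mu>" ..
  interpret P: prob_space ?P by (rule prob_space_primitives)
  interpret NP: pair_prob_space ?N ?P ..
  have [measurable]: "(\<lambda>x. (snd x)(n := fst x)) \<in> ?N \<Otimes>\<^sub>M ?P \<rightarrow>\<^sub>M ?P"
    unfolding primitives_def by (rule measurable_fun_upd[where J=UNIV]) auto
  have "distr (?N \<Otimes>\<^sub>M ?P) ?P (\<lambda>(x, X). X(n := x)) = ?P"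
    using distr_pair_PiM_eq_PiM[of UNIV "\<lambda>_::nat. ?N" n]
    by (simp add: primitives_def EFE.prob_space_axioms)
  then have "(\<integral>\<^sup>+\<xi>. f \<xi> \<partial>?P) = (\<integral>\<^sup>+\<xi>. f \<xi> \<partial>distr (?N \<Otimes>\<^sub>M ?P) ?P (\<lambda>(x, X). X(n := x)))"
    by simp
  also have "\<dots> = (\<integral>\<^sup>+x. f ((snd x)(n := fst x)) \<partial>(?N \<Otimes>\<^sub>M ?P))"
    by (subst nn_integral_distr) (auto simp: split_beta)
  also have "\<dots> = (\<integral>\<^sup>+\<xi>. (\<integral>\<^sup>+x. f (\<xi>(n := x)) \<partial>?N) \<partial>?P)"
    by (subst NP.nn_integral_snd[symmetric]) auto
  also have "\<dots> = (\<integral>\<^sup>+\<xi>. (\<integral>\<^sup>+u. (\<integral>\<^sup>+w. (\<integral>\<^sup>+s. f (\<xi>(n := (u, w, s))) \<partial>exp_dist \<mu>) \<partial>F) \<partial>exp_dist \<Lambda>) \<partial>?P)"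
  proof (rule nn_integral_cong)
    fix \<xi> :: sample
    have "(\<lambda>x. \<xi>(n := x)) \<in> ?N \<rightarrow>\<^sub>M ?P"
      unfolding primitives_def by (rule measurable_fun_upd[where J=UNIV]) (auto simp: space_PiM space_pair_measure)
    then have mf: "(\<lambda>x. f (\<xi>(n := x))) \<in> borel_measurable ?N"
      using f by (rule measurable_compose)
    have mf': "(\<lambda>x. f (\<xi>(n := (u, x)))) \<in> borel_measurable (F \<Otimes>\<^sub>M exp_dist \<mu>)" for u
      by (rule measurable_compose[OF measurable_Pair1' mf]) simp
    show "(\<integral>\<^sup>+x. f (\<xi>(n := x)) \<partial>?N) = (\<integral>\<^sup>+u. (\<integral>\<^sup>+w. (\<integral>\<^sup>+s. f (\<xi>(n := (u, w, s))) \<partial>exp_dist \<mu>) \<partial>F) \<partial>exp_dist \<Lambda>)"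
      by (simp add: FE.P.nn_integral_fst[OF mf, symmetric] E2.nn_integral_fst[OF mf', symmetric])
  qed
  finally show ?thesis .
qed

end

text \<open>\<open>resample\<close> for the indicator of the exceptional set. It reduces an almost
  sure statement about the whole sample to null sets in the variables of one customer.\<close>

lemma AE_resample:
  assumes "0 < \<Lambda>" "0 < \<mu>" "real_distribution F"
    and G: "Measurable.pred (primitives \<Lambda> \<mu> F) G"
    and ae: "AE \<xi> in primitives \<Lambda> \<mu> F. AE u in exp_dist \<Lambda>. AE w in F. AE s in exp_dist \<mu>. G (\<xi>(n := (u, w, s)))"
  shows "AE \<xi> in primitives \<Lambda> \<mu> F. G \<xi>"
proof -
  let ?P = "primitives \<Lambda> \<mu> F"
  define f :: "sample \<Rightarrow> ennreal" where "f \<xi> = indicator {\<xi>. \<not> G \<xi>} \<xi>" for \<xi>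
  have f[measurable]: "f \<in> borel_measurable ?P"
  proof -
    have "{\<xi> \<in> space ?P. \<not> G \<xi>} \<in> sets ?P"
      using G by measurable
    then show ?thesis
      unfolding f_def by (auto simp: space_primitives[OF assms(1-3)])
  qed
  have "(\<integral>\<^sup>+\<xi>. f \<xi> \<partial>?P) = (\<integral>\<^sup>+\<xi>. (\<integral>\<^sup>+u. (\<integral>\<^sup>+w. (\<integral>\<^sup>+s. f (\<xi>(n := (u, w, s))) \<partial>exp_dist \<mu>) \<partial>F) \<partial>exp_dist \<Lambda>) \<partial>?P)"
    by (rule resample[OF assms(1-3)]) measurable
  also have "\<dots> = (\<integral>\<^sup>+\<xi>. 0 \<partial>?P)"
  proof (rule nn_integral_cong_AE, use ae in eventually_elim)
    case (elim \<xi>)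
    have "(\<integral>\<^sup>+u. (\<integral>\<^sup>+w. (\<integral>\<^sup>+s. f (\<xi>(n := (u, w, s))) \<partial>exp_dist \<mu>) \<partial>F) \<partial>exp_dist \<Lambda>)
        = (\<integral>\<^sup>+u. (\<integral>\<^sup>+w. (\<integral>\<^sup>+s. 0 \<partial>exp_dist \<mu>) \<partial>F) \<partial>exp_dist \<Lambda>)"
    proof (rule nn_integral_cong_AE, use elim in eventually_elim)
      case (elim u)
      show ?case
      proof (rule nn_integral_cong_AE, use elim in eventually_elim)
        case (elim w)
        show ?case
          by (rule nn_integral_cong_AE, use elim in eventually_elim) (simp add: f_def)
      qed
    qed
    then show ?case by simp
  qed
  finally have "(\<integral>\<^sup>+\<xi>. f \<xi> \<partial>?P) = 0" by simp
  then have "AE \<xi> in ?P. f \<xi> = 0" by (simp add: nn_integral_0_iff_AE)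
  then show ?thesis by (rule eventually_mono) (simp add: f_def indicator_def split: if_splits)
qed

subsection \<open>Sample paths\<close>

definition busy :: "real \<Rightarrow> history \<Rightarrow> nat" where
  "busy t h = card {n. case h n of (a, w, b, e) \<Rightarrow> b \<and> a < t \<and> t \<le> e}"

lemma available_eq_busy: "available C h t = C - busy t h"
  by (simp add: available_def busy_def)

text \<open>Censoring departures at t preserves the test \<open>t \<le> e\<close>, and dummy records
  fail \<open>a < t\<close>. Hence the occupancy is a function of what has been observed.\<close>

lemma busy_history_before [simp]: "busy t (history_before t d) = busy t d"
  unfolding busy_def history_before_def by (intro arg_cong[where f=card] Collect_cong) (auto split: prod.splits)

text \<open>\<open>demand\<close> says that a customer facing the price \<open>p l\<close> buys with
  probability \<open>l / \<Lambda>\<close>. The policy is a parameter, so that the given policy and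
  its static competitor are two interpretations over the same \<open>p\<close> and the same sample
  space.\<close>

locale loss_system =
  fixes C :: nat and \<Lambda> \<mu> :: real and F :: "real measure" and p :: "real \<Rightarrow> real" and \<pi> :: policy
  assumes \<Lambda>_pos: "0 < \<Lambda>" and \<mu>_pos: "0 < \<mu>" and real_distribution_F: "real_distribution F"
    and admissible: "admissible \<Lambda> \<pi>"
    and demand: "\<And>l. 0 \<le> l \<Longrightarrow> l \<le> \<Lambda> \<Longrightarrow> \<Lambda> * measure F {p l<..} = l"
begin

sublocale F: real_distribution F by (rule real_distribution_F)

abbreviation "Pr \<equiv> primitives \<Lambda> \<mu> F"
abbreviation "traj \<equiv> trajectory C p \<pi>"
abbreviation "T \<equiv> arrival_time"

definition hist :: "sample \<Rightarrow> real \<Rightarrow> history" where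
  "hist \<xi> t = history_before t (traj \<xi>)"

text \<open>Phrased with the completed trajectory instead of stage n of the recursion
  \<open>customers\<close>; \<open>trajectory_eq\<close> shows that both agree when all times are
  positive.\<close>

definition sold :: "sample \<Rightarrow> nat \<Rightarrow> bool" where
  "sold \<xi> n \<longleftrightarrow> busy (T \<xi> n) (hist \<xi> (T \<xi> n)) < C \<and> p (\<pi> (T \<xi> n) (hist \<xi> (T \<xi> n))) < wtp \<xi> n"

definition departure :: "sample \<Rightarrow> nat \<Rightarrow> real" where
  "departure \<xi> n = T \<xi> n + service_time \<xi> n"

definition pos :: "sample \<Rightarrow> bool" where
  "pos \<xi> \<longleftrightarrow> (\<forall>n. 0 < fst (\<xi> n) \<and> 0 < service_time \<xi> n)"

sublocale prob_space Pr
  by (rule prob_space_primitives[OF \<Lambda>_pos \<mu>_pos real_distribution_F])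

lemma \<pi>_bounds: "0 \<le> \<pi> t h" "\<pi> t h \<le> \<Lambda>"
  using admissible by (auto simp: admissible_def)

lemma \<pi>_measurable [measurable]: "case_prod \<pi> \<in> borel_measurable (borel \<Otimes>\<^sub>M history_space)"
  using admissible by (auto simp: admissible_def case_prod_beta')

lemma price_antimono:
  assumes "0 \<le> l" "l \<le> l'" "l' \<le> \<Lambda>"
  shows "p l' \<le> p l"
proof (rule ccontr)
  assume *: "\<not> p l' \<le> p l"
  have "measure F {p l'<..} \<le> measure F {p l<..}"
    using * by (intro F.finite_measure_mono) auto
  then have "l' \<le> l"
    using demand[of l] demand[of l'] assms \<Lambda>_pos by (metis mult_le_cancel_left_pos order_trans)
  with assms * show False by auto
qed

text \<open>Outside the interval from \<open>0\<close> to \<^term>\<open>\<Lambda>\<close> nothing is assumed about \<^term>\<open>p\<close>, not even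
  measurability.\<close>

definition price_ext :: "real \<Rightarrow> real" where
  "price_ext l = p (max 0 (min \<Lambda> l))"

lemma price_ext: "p (\<pi> t h) = price_ext (\<pi> t h)"
  using \<pi>_bounds[of t h] by (simp add: price_ext_def max_def min_def)

lemma price_ext_measurable [measurable]: "price_ext \<in> borel_measurable borel"
proof -
  have "mono (\<lambda>l. - price_ext l)"
    using \<Lambda>_pos unfolding mono_def price_ext_def by (auto intro!: price_antimono)
  then have "(\<lambda>l. - (- price_ext l)) \<in> borel_measurable borel"
    by (intro borel_measurable_uminus borel_measurable_mono)
  then show ?thesis by simp
qed

lemma T_mono_strict: "pos \<xi> \<Longrightarrow> strict_mono (T \<xi>)"
  by (rule strict_monoI_Suc) (simp add: arrival_time_def pos_def)

lemma T_less_iff: "pos \<xi> \<Longrightarrow> T \<xi> j < T \<xi> k \<longleftrightarrow> j < k"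
  using T_mono_strict strict_mono_less by blast

lemma T_le_iff: "pos \<xi> \<Longrightarrow> T \<xi> j \<le> T \<xi> k \<longleftrightarrow> j \<le> k"
  using T_mono_strict strict_mono_less_eq by blast

lemma T_pos: "pos \<xi> \<Longrightarrow> 0 < T \<xi> n"
  unfolding arrival_time_def pos_def by (intro sum_pos) auto

lemma departure_gt: "pos \<xi> \<Longrightarrow> T \<xi> n < departure \<xi> n"
  by (simp add: departure_def pos_def)

lemma customers_provisional: "n \<le> k \<Longrightarrow> customers C p \<pi> \<xi> n k = (T \<xi> k, wtp \<xi> k, False, T \<xi> k)"
  by (induction n) (auto simp: Let_def)

lemma customers_final: "k < n \<Longrightarrow> customers C p \<pi> \<xi> n k = traj \<xi> k"
proof (induction n)
  case (Suc n)
  then show ?case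
    by (cases "k = n") (auto simp: Let_def trajectory_def)
qed simp

lemma trajectory_raw:
  "traj \<xi> n = (T \<xi> n, wtp \<xi> n, let d = customers C p \<pi> \<xi> n in
     (0 < available C d (T \<xi> n) \<and> p (rate \<pi> d (T \<xi> n)) < wtp \<xi> n),
     let d = customers C p \<pi> \<xi> n in if 0 < available C d (T \<xi> n) \<and> p (rate \<pi> d (T \<xi> n)) < wtp \<xi> n
       then T \<xi> n + service_time \<xi> n else T \<xi> n)"
  by (simp add: trajectory_def Let_def)

lemma history_before_customers:
  assumes "pos \<xi>"
  shows "history_before (T \<xi> n) (customers C p \<pi> \<xi> n) = hist \<xi> (T \<xi> n)"
proof
  fix k
  show "history_before (T \<xi> n) (customers C p \<pi> \<xi> n) k = hist \<xi> (T \<xi> n) k"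
  proof (cases "k < n")
    case True
    then show ?thesis by (simp add: hist_def history_before_def customers_final)
  next
    case False
    then have "T \<xi> n \<le> T \<xi> k" using assms by (simp add: T_le_iff)
    with False show ?thesis
      by (simp add: hist_def history_before_def customers_provisional trajectory_raw[of \<xi> k])
  qed
qed

lemma trajectory_eq:
  assumes "pos \<xi>"
  shows "traj \<xi> n = (T \<xi> n, wtp \<xi> n, sold \<xi> n, if sold \<xi> n then departure \<xi> n else T \<xi> n)"
proof -
  let ?d = "customers C p \<pi> \<xi> n"
  have "available C ?d (T \<xi> n) = C - busy (T \<xi> n) (hist \<xi> (T \<xi> n))"
    using busy_history_before[of "T \<xi> n" ?d] by (simp add: available_eq_busy history_before_customers[OF assms])
  then show ?thesis
    by (subst trajectory_raw)
       (simp add: rate_def history_before_customers[OF assms] sold_def departure_def)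
qed

lemma hist_eq:
  assumes "pos \<xi>"
  shows "hist \<xi> t k = (if T \<xi> k < t then (T \<xi> k, wtp \<xi> k, sold \<xi> k,
      min (if sold \<xi> k then departure \<xi> k else T \<xi> k) t) else (t, 0, False, t))"
  by (simp add: hist_def history_before_def trajectory_eq[OF assms])

lemma busy_hist:
  assumes "pos \<xi>"
  shows "busy t (hist \<xi> t) = card {n. sold \<xi> n \<and> T \<xi> n < t \<and> t \<le> departure \<xi> n}"
  unfolding busy_def by (intro arg_cong[where f=card] Collect_cong) (auto simp: hist_eq[OF assms])

text \<open>The history before \<^term>\<open>t\<close> reveals a service time only if it ends before \<^term>\<open>t\<close>.\<close>

lemma hist_cong:
  assumes "pos \<xi>" "pos \<xi>'"
    and same: "\<And>k. T \<xi> k < t \<or> T \<xi>' k < t \<Longrightarrow> T \<xi> k = T \<xi>' k \<and> wtp \<xi> k = wtp \<xi>' k \<and>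
      (service_time \<xi> k = service_time \<xi>' k \<or> t \<le> departure \<xi> k \<and> t \<le> departure \<xi>' k)"
  shows "hist \<xi> t = hist \<xi>' t"
proof -
  have step: "hist \<xi> r = hist \<xi>' r" if r: "r \<le> t" and sold: "\<And>j. T \<xi> j < r \<Longrightarrow> sold \<xi> j = sold \<xi>' j" for r
  proof
    fix j
    show "hist \<xi> r j = hist \<xi>' r j"
      using same[of j] sold[of j] r by (auto simp: hist_eq assms(1,2) departure_def)
  qed
  \<comment> \<open>Equal primitives do not give equal sales at once, because a sale depends on the
    history before it. The induction works since only earlier customers enter the decision about
    customer k.\<close>
  have "T \<xi> k < t \<longrightarrow> sold \<xi> k = sold \<xi>' k" for k
  proof (induction k rule: less_induct)
    case (less k)
    show ?case
    proof
      assume t: "T \<xi> k < t"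
      then have "sold \<xi> j = sold \<xi>' j" if "T \<xi> j < T \<xi> k" for j
        using that less.IH[of j] T_less_iff[OF assms(1), of j k] by auto
      then have "hist \<xi> (T \<xi> k) = hist \<xi>' (T \<xi> k)"
        using t by (intro step) auto
      then show "sold \<xi> k = sold \<xi>' k"
        using same[of k] t by (auto simp: sold_def)
    qed
  qed
  then show ?thesis by (intro step) auto
qed

end

subsection \<open>Measurability and compensators\<close>

lemma arrival_time_upd:
  "arrival_time (\<xi>(n := x)) k = (if n \<le> k then arrival_time \<xi> k - fst (\<xi> n) + fst x else arrival_time \<xi> k)"
proof (induction k)
  case (Suc k)
  have "arrival_time \<xi>' (Suc k) = arrival_time \<xi>' k + fst (\<xi>' (Suc k))" for \<xi>'
    by (simp add: arrival_time_def)
  with Suc show ?case by (auto simp: le_Suc_eq)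
qed (auto simp: arrival_time_def)

lemma wtp_upd: "wtp (\<xi>(n := x)) k = (if k = n then fst (snd x) else wtp \<xi> k)"
  by (simp add: wtp_def)

lemma service_time_upd: "service_time (\<xi>(n := x)) k = (if k = n then snd (snd x) else service_time \<xi> k)"
  by (simp add: service_time_def)

lemma history_component_measurable:
  "(\<lambda>h. h n) \<in> history_space \<rightarrow>\<^sub>M borel \<Otimes>\<^sub>M borel \<Otimes>\<^sub>M count_space UNIV \<Otimes>\<^sub>M borel"
  unfolding history_space_def by (rule measurable_component_singleton) simp

lemma history_measurableI:
  "(\<And>n. (\<lambda>x. f x n) \<in> M \<rightarrow>\<^sub>M borel \<Otimes>\<^sub>M borel \<Otimes>\<^sub>M count_space UNIV \<Otimes>\<^sub>M borel) \<Longrightarrow> f \<in> M \<rightarrow>\<^sub>M history_space"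
  unfolding history_space_def by (rule measurable_abs_UNIV)

lemma history_before_measurable [measurable (raw)]:
  assumes [measurable]: "f \<in> M \<rightarrow>\<^sub>M borel" and g: "g \<in> M \<rightarrow>\<^sub>M history_space"
  shows "(\<lambda>x. history_before (f x) (g x)) \<in> M \<rightarrow>\<^sub>M history_space"
proof (rule history_measurableI)
  fix n
  have [measurable]: "(\<lambda>x. g x n) \<in> M \<rightarrow>\<^sub>M borel \<Otimes>\<^sub>M borel \<Otimes>\<^sub>M count_space UNIV \<Otimes>\<^sub>M borel"
    using g history_component_measurable by (rule measurable_compose)
  show "(\<lambda>x. history_before (f x) (g x) n) \<in> M \<rightarrow>\<^sub>M borel \<Otimes>\<^sub>M borel \<Otimes>\<^sub>M count_space UNIV \<Otimes>\<^sub>M borel"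
    unfolding history_before_def case_prod_beta' by measurable
qed

lemma busy_measurable [measurable (raw)]:
  assumes [measurable]: "f \<in> M \<rightarrow>\<^sub>M borel" and g: "g \<in> M \<rightarrow>\<^sub>M history_space"
  shows "(\<lambda>x. busy (f x) (g x)) \<in> M \<rightarrow>\<^sub>M count_space UNIV"
proof -
  have [measurable]: "(\<lambda>x. g x n) \<in> M \<rightarrow>\<^sub>M borel \<Otimes>\<^sub>M borel \<Otimes>\<^sub>M count_space UNIV \<Otimes>\<^sub>M borel" for n
    using g history_component_measurable by (rule measurable_compose)
  show ?thesis
    unfolding busy_def case_prod_beta' by measurable
qed

context loss_system
begin

lemma sets_Pr [measurable_cong]: "sets Pr = sets (Pi\<^sub>M UNIV (\<lambda>_::nat. borel \<Otimes>\<^sub>M borel \<Otimes>\<^sub>M borel))"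
  by (rule sets_primitives[OF \<Lambda>_pos \<mu>_pos real_distribution_F])

lemma space_Pr [simp]: "space Pr = UNIV"
  by (rule space_primitives[OF \<Lambda>_pos \<mu>_pos real_distribution_F])

lemma upd_measurable [measurable (raw)]:
  assumes "f \<in> M \<rightarrow>\<^sub>M Pr" "g \<in> M \<rightarrow>\<^sub>M borel \<Otimes>\<^sub>M borel \<Otimes>\<^sub>M borel"
  shows "(\<lambda>x. (f x)(n := g x)) \<in> M \<rightarrow>\<^sub>M Pr"
  using assms unfolding measurable_cong_sets[OF refl sets_Pr]
  by (intro measurable_fun_upd[where J=UNIV]) auto

lemma T_measurable [measurable]: "(\<lambda>\<xi>. T \<xi> n) \<in> borel_measurable Pr"
  unfolding arrival_time_def by measurable

lemma wtp_measurable [measurable]: "(\<lambda>\<xi>. wtp \<xi> n) \<in> borel_measurable Pr"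
  unfolding wtp_def by measurable

lemma service_time_measurable [measurable]: "(\<lambda>\<xi>. service_time \<xi> n) \<in> borel_measurable Pr"
  unfolding service_time_def by measurable

lemma \<pi>_measurable' [measurable (raw)]:
  assumes [measurable]: "f \<in> M \<rightarrow>\<^sub>M borel" "g \<in> M \<rightarrow>\<^sub>M history_space"
  shows "(\<lambda>x. \<pi> (f x) (g x)) \<in> borel_measurable M"
  using measurable_compose[OF measurable_Pair[OF assms] \<pi>_measurable] by simp

lemma traj_measurable [measurable]: "traj \<in> Pr \<rightarrow>\<^sub>M history_space"
proof -
  have [measurable]: "(\<lambda>\<xi>. customers C p \<pi> \<xi> n) \<in> Pr \<rightarrow>\<^sub>M history_space" for n
  proof (induction n)
    case 0
    show ?case by (rule history_measurableI) simp
  next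
    case (Suc n)
    note [measurable] = Suc
    have [measurable]: "(\<lambda>\<xi>. customers C p \<pi> \<xi> n k) \<in> Pr \<rightarrow>\<^sub>M borel \<Otimes>\<^sub>M borel \<Otimes>\<^sub>M count_space UNIV \<Otimes>\<^sub>M borel" for k
      using Suc history_component_measurable by (rule measurable_compose)
    show ?case
      by (rule history_measurableI)
         (auto simp: Let_def available_eq_busy rate_def price_ext fun_upd_def)
  qed
  have "(\<lambda>\<xi>. customers C p \<pi> \<xi> n k) \<in> Pr \<rightarrow>\<^sub>M borel \<Otimes>\<^sub>M borel \<Otimes>\<^sub>M count_space UNIV \<Otimes>\<^sub>M borel" for n k
    by (rule measurable_compose[OF _ history_component_measurable]) measurable
  then show ?thesis
    by (intro history_measurableI) (simp add: trajectory_def del: customers.simps)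
qed

lemma hist_measurable [measurable (raw)]:
  assumes [measurable]: "f \<in> M \<rightarrow>\<^sub>M Pr" "g \<in> M \<rightarrow>\<^sub>M borel"
  shows "(\<lambda>x. hist (f x) (g x)) \<in> M \<rightarrow>\<^sub>M history_space"
  unfolding hist_def by measurable

lemma sold_measurable [measurable]: "Measurable.pred Pr (\<lambda>\<xi>. sold \<xi> n)"
  unfolding sold_def price_ext by measurable

lemma departure_measurable [measurable]: "(\<lambda>\<xi>. departure \<xi> n) \<in> borel_measurable Pr"
  unfolding departure_def by measurable

lemma pos_upd: "pos \<xi> \<Longrightarrow> 0 < u \<Longrightarrow> 0 < s \<Longrightarrow> pos (\<xi>(n := (u, w, s)))"
  by (auto simp: pos_def service_time_upd)

lemma AE_pos: "AE \<xi> in Pr. pos \<xi>"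
proof -
  have "AE \<xi> in Pr. 0 < fst (\<xi> n) \<and> 0 < service_time \<xi> n" for n
  proof (rule AE_resample[OF \<Lambda>_pos \<mu>_pos real_distribution_F, of _ n])
    show "AE \<xi> in Pr. AE u in exp_dist \<Lambda>. AE w in F. AE s in exp_dist \<mu>.
        0 < fst ((\<xi>(n := (u, w, s))) n) \<and> 0 < service_time (\<xi>(n := (u, w, s))) n"
      using AE_exp_dist_pos[OF \<Lambda>_pos] AE_exp_dist_pos[OF \<mu>_pos]
      by (auto simp: service_time_upd elim!: eventually_mono)
  qed measurable
  then show ?thesis by (simp add: pos_def AE_all_countable)
qed

text \<open>\<open>T \<xi> n - fst (\<xi> n)\<close> is the arrival time of the previous customer,
  or 0. On both paths no customer from n on arrives strictly before v time units later, so the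
  history there is the same as if customer n arrived exactly at that moment.\<close>

lemma hist_arrival_cong:
  assumes "pos \<xi>" "0 < v" "v \<le> u" "0 < s" "0 < s'"
  shows "hist (\<xi>(n := (u, w, s))) (T \<xi> n - fst (\<xi> n) + v) = hist (\<xi>(n := (v, w', s'))) (T \<xi> n - fst (\<xi> n) + v)"
proof (rule hist_cong)
  show "pos (\<xi>(n := (u, w, s)))" "pos (\<xi>(n := (v, w', s')))"
    using assms by (auto intro!: pos_upd)
  fix k
  assume *: "T (\<xi>(n := (u, w, s))) k < T \<xi> n - fst (\<xi> n) + v \<or> T (\<xi>(n := (v, w', s'))) k < T \<xi> n - fst (\<xi> n) + v"
  have "k < n"
  proof (rule ccontr)
    assume "\<not> k < n"
    then have "T \<xi> n \<le> T \<xi> k" using assms by (simp add: T_le_iff)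
    with * \<open>\<not> k < n\<close> assms show False by (auto simp: arrival_time_upd split: if_splits)
  qed
  then show "T (\<xi>(n := (u, w, s))) k = T (\<xi>(n := (v, w', s'))) k \<and> wtp (\<xi>(n := (u, w, s))) k = wtp (\<xi>(n := (v, w', s'))) k \<and>
     (service_time (\<xi>(n := (u, w, s))) k = service_time (\<xi>(n := (v, w', s'))) k \<or>
      T \<xi> n - fst (\<xi> n) + v \<le> departure (\<xi>(n := (u, w, s))) k \<and> T \<xi> n - fst (\<xi> n) + v \<le> departure (\<xi>(n := (v, w', s'))) k)"
    by (simp add: arrival_time_upd wtp_upd service_time_upd)
qed

text \<open>Both departures of customer n lie at or after t, so censoring hides which service time
  was drawn. The boundary case is the one that counts: \<open>nn_integral_departure\<close> compares
  a path at time t with the path on which the customer departs exactly at t.\<close>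

lemma hist_service_cong:
  assumes "pos \<xi>" "0 < u" "0 < s" "0 < s'" "t \<le> T \<xi> n - fst (\<xi> n) + u + min s s'"
  shows "hist (\<xi>(n := (u, w, s))) t = hist (\<xi>(n := (u, w, s'))) t"
  by (rule hist_cong)
     (use assms in \<open>auto intro!: pos_upd simp: arrival_time_upd wtp_upd service_time_upd departure_def\<close>)

lemma nn_integral_lborel_shift:
  fixes f :: "real \<Rightarrow> ennreal"
  assumes [measurable]: "f \<in> borel_measurable borel"
  shows "(\<integral>\<^sup>+t. f t \<partial>lborel) = (\<integral>\<^sup>+t. f (a + t) \<partial>lborel)"
  using nn_integral_real_affine[of f 1 a] by simp

lemma nn_integral_F_greater: "(\<integral>\<^sup>+w. (if p (\<pi> t h) < w then a else 0) \<partial>F) = a * ennreal (\<pi> t h / \<Lambda>)"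
proof -
  have "(\<integral>\<^sup>+w. (if p (\<pi> t h) < w then a else 0) \<partial>F) = (\<integral>\<^sup>+w. a * indicator {p (\<pi> t h)<..} w \<partial>F)"
    by (intro nn_integral_cong) auto
  also have "\<dots> = a * emeasure F {p (\<pi> t h)<..}"
    by (rule nn_integral_cmult_indicator) simp
  also have "emeasure F {p (\<pi> t h)<..} = ennreal (\<pi> t h / \<Lambda>)"
  proof -
    have "measure F {p (\<pi> t h)<..} = \<pi> t h / \<Lambda>"
      using demand[OF \<pi>_bounds, of t h] \<Lambda>_pos by (subst eq_divide_eq) (auto simp: mult.commute)
    then show ?thesis by (simp add: F.emeasure_eq_measure)
  qed
  finally show ?thesis .
qed

text \<open>Until customer \<^term>\<open>n\<close> arrives, the history does not depend on the interarrival time, which therefore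
  acts as an exponential clock on a fixed path; the same holds for a service time in progress.\<close>

lemma nn_integral_arrival:
  fixes z :: "real \<Rightarrow> history \<Rightarrow> ennreal"
  assumes z: "case_prod z \<in> borel_measurable (borel \<Otimes>\<^sub>M history_space)"
  shows "(\<integral>\<^sup>+\<xi>. (if p (\<pi> (T \<xi> n) (hist \<xi> (T \<xi> n))) < wtp \<xi> n then z (T \<xi> n) (hist \<xi> (T \<xi> n)) else 0) \<partial>Pr)
    = (\<integral>\<^sup>+\<xi>. (\<integral>\<^sup>+t. z t (hist \<xi> t) * ennreal (\<pi> t (hist \<xi> t)) * indicator {T \<xi> n - fst (\<xi> n)<..T \<xi> n} t \<partial>lborel) \<partial>Pr)"
    (is "(\<integral>\<^sup>+\<xi>. ?f \<xi> \<partial>Pr) = (\<integral>\<^sup>+\<xi>. ?g \<xi> \<partial>Pr)")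
proof -
  interpret E1: prob_space "exp_dist \<Lambda>" by (rule prob_space_exponential_density[OF \<Lambda>_pos])
  interpret E2: prob_space "exp_dist \<mu>" by (rule prob_space_exponential_density[OF \<mu>_pos])
  have zm[measurable (raw)]: "(\<lambda>x. z (f x) (g x)) \<in> borel_measurable M"
    if "f \<in> M \<rightarrow>\<^sub>M borel" "g \<in> M \<rightarrow>\<^sub>M history_space" for f g and M :: "'x measure"
    using measurable_compose[OF measurable_Pair[OF that] z] by simp
  define k where "k t h = z t h * ennreal (\<pi> t h / \<Lambda>)" for t h
  \<comment> \<open>The path on which customer n arrives u after its predecessor. The entries 0 and
    1 are placeholders: the history before the arrival reveals neither valuation nor service
    time.\<close>
  define \<psi> where "\<psi> \<xi> u = k (T \<xi> n - fst (\<xi> n) + u) (hist (\<xi>(n := (u, 0, 1))) (T \<xi> n - fst (\<xi> n) + u))" for \<xi> u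
  have kz: "ennreal \<Lambda> * k t h = z t h * ennreal (\<pi> t h)" for t h
  proof -
    have "ennreal \<Lambda> * ennreal (\<pi> t h / \<Lambda>) = ennreal (\<pi> t h)"
      using \<Lambda>_pos \<pi>_bounds[of t h] by (simp add: ennreal_mult[symmetric])
    then show ?thesis unfolding k_def by (metis mult.left_commute)
  qed
  have fm[measurable]: "?f \<in> borel_measurable Pr"
    unfolding price_ext by measurable
  have gm[measurable]: "?g \<in> borel_measurable Pr"
    unfolding indicator_def greaterThanAtMost_iff by measurable
  have "(\<integral>\<^sup>+\<xi>. ?f \<xi> \<partial>Pr) = (\<integral>\<^sup>+\<xi>. (\<integral>\<^sup>+u. (\<integral>\<^sup>+w. (\<integral>\<^sup>+s. ?f (\<xi>(n := (u, w, s))) \<partial>exp_dist \<mu>) \<partial>F) \<partial>exp_dist \<Lambda>) \<partial>Pr)"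
    by (rule resample[OF \<Lambda>_pos \<mu>_pos real_distribution_F]) measurable
  also have "\<dots> = (\<integral>\<^sup>+\<xi>. (\<integral>\<^sup>+u. \<psi> \<xi> u \<partial>exp_dist \<Lambda>) \<partial>Pr)"
  proof (rule nn_integral_cong_AE, use AE_pos in eventually_elim)
    case (elim \<xi>)
    show ?case
    proof (rule nn_integral_cong_AE, use AE_exp_dist_pos[OF \<Lambda>_pos] in eventually_elim)
      case (elim u)
      let ?t = "T \<xi> n - fst (\<xi> n) + u"
      let ?h = "hist (\<xi>(n := (u, 0, 1))) ?t"
      have "(\<integral>\<^sup>+w. (\<integral>\<^sup>+s. ?f (\<xi>(n := (u, w, s))) \<partial>exp_dist \<mu>) \<partial>F)
          = (\<integral>\<^sup>+w. (\<integral>\<^sup>+s. (if p (\<pi> ?t ?h) < w then z ?t ?h else 0) \<partial>exp_dist \<mu>) \<partial>F)"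
      proof (rule nn_integral_cong, rule nn_integral_cong_AE, use AE_exp_dist_pos[OF \<mu>_pos] in eventually_elim)
        case (elim w s)
        then show ?case
          using hist_arrival_cong[OF \<open>pos \<xi>\<close> \<open>0 < u\<close> order_refl, of s 1 n w 0]
          by (simp add: arrival_time_upd wtp_upd)
      qed
      also have "\<dots> = z ?t ?h * ennreal (\<pi> ?t ?h / \<Lambda>)"
        by (simp add: nn_integral_F_greater E2.emeasure_space_1[simplified])
      finally show ?case by (simp add: \<psi>_def k_def)
    qed
  qed
  also have "\<dots> = (\<integral>\<^sup>+\<xi>. (\<integral>\<^sup>+u. (\<integral>\<^sup>+v. ennreal \<Lambda> * \<psi> \<xi> v * indicator {0<..u} v \<partial>lborel) \<partial>exp_dist \<Lambda>) \<partial>Pr)"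
  proof (rule nn_integral_cong)
    fix \<xi> :: sample
    have "\<psi> \<xi> \<in> borel_measurable borel"
      unfolding \<psi>_def k_def by measurable
    then show "(\<integral>\<^sup>+u. \<psi> \<xi> u \<partial>exp_dist \<Lambda>)
        = (\<integral>\<^sup>+u. (\<integral>\<^sup>+v. ennreal \<Lambda> * \<psi> \<xi> v * indicator {0<..u} v \<partial>lborel) \<partial>exp_dist \<Lambda>)"
      by (rule exponential_clock[OF \<Lambda>_pos])
  qed
  also have "\<dots> = (\<integral>\<^sup>+\<xi>. (\<integral>\<^sup>+u. (\<integral>\<^sup>+w. (\<integral>\<^sup>+s. ?g (\<xi>(n := (u, w, s))) \<partial>exp_dist \<mu>) \<partial>F) \<partial>exp_dist \<Lambda>) \<partial>Pr)"
  proof (rule nn_integral_cong_AE, use AE_pos in eventually_elim)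
    case (elim \<xi>)
    show ?case
    proof (rule nn_integral_cong_AE, use AE_exp_dist_pos[OF \<Lambda>_pos] in eventually_elim)
      case (elim u)
      let ?I = "\<integral>\<^sup>+v. ennreal \<Lambda> * \<psi> \<xi> v * indicator {0<..u} v \<partial>lborel"
      have "(\<integral>\<^sup>+w. (\<integral>\<^sup>+s. ?g (\<xi>(n := (u, w, s))) \<partial>exp_dist \<mu>) \<partial>F)
          = (\<integral>\<^sup>+w. (\<integral>\<^sup>+s. ?I \<partial>exp_dist \<mu>) \<partial>F)"
      proof (rule nn_integral_cong, rule nn_integral_cong_AE, use AE_exp_dist_pos[OF \<mu>_pos] in eventually_elim)
        case (elim w s)
        let ?\<xi> = "\<xi>(n := (u, w, s))" and ?a = "T \<xi> n - fst (\<xi> n)"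
        have "?g ?\<xi> = (\<integral>\<^sup>+t. ennreal \<Lambda> * k t (hist ?\<xi> t) * indicator {?a<..?a + u} t \<partial>lborel)"
          by (simp add: kz arrival_time_upd)
        also have "\<dots> = (\<integral>\<^sup>+v. ennreal \<Lambda> * k (?a + v) (hist ?\<xi> (?a + v)) * indicator {?a<..?a + u} (?a + v) \<partial>lborel)"
          unfolding k_def by (rule nn_integral_lborel_shift) measurable
        also have "\<dots> = ?I"
          by (rule nn_integral_cong)
             (use \<open>pos \<xi>\<close> \<open>0 < u\<close> \<open>0 < s\<close> hist_arrival_cong[of \<xi> _ u s 1 n w 0] in
               \<open>auto simp: \<psi>_def split: split_indicator\<close>)
        finally show ?case .
      qed
      then show ?case by (simp add: E2.emeasure_space_1[simplified] F.emeasure_space_1[simplified])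
    qed
  qed
  also have "\<dots> = (\<integral>\<^sup>+\<xi>. ?g \<xi> \<partial>Pr)"
    by (rule resample[OF \<Lambda>_pos \<mu>_pos real_distribution_F, symmetric]) measurable
  finally show ?thesis .
qed

text \<open>Here the service time of customer n is the clock. It starts only if a unit is sold, and
  this is decided before the service time can influence anything.\<close>

lemma nn_integral_departure:
  fixes z :: "real \<Rightarrow> history \<Rightarrow> ennreal"
  assumes z: "case_prod z \<in> borel_measurable (borel \<Otimes>\<^sub>M history_space)"
  shows "(\<integral>\<^sup>+\<xi>. (if sold \<xi> n then z (departure \<xi> n) (hist \<xi> (departure \<xi> n)) else 0) \<partial>Pr)
    = (\<integral>\<^sup>+\<xi>. (if sold \<xi> n then
        (\<integral>\<^sup>+t. ennreal \<mu> * z t (hist \<xi> t) * indicator {T \<xi> n<..departure \<xi> n} t \<partial>lborel) else 0) \<partial>Pr)"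
    (is "(\<integral>\<^sup>+\<xi>. ?f \<xi> \<partial>Pr) = (\<integral>\<^sup>+\<xi>. ?g \<xi> \<partial>Pr)")
proof -
  have zm[measurable (raw)]: "(\<lambda>x. z (f x) (g x)) \<in> borel_measurable M"
    if "f \<in> M \<rightarrow>\<^sub>M borel" "g \<in> M \<rightarrow>\<^sub>M history_space" for f g and M :: "'x measure"
    using measurable_compose[OF measurable_Pair[OF that] z] by simp
  have fm[measurable]: "?f \<in> borel_measurable Pr"
    by measurable
  have gm[measurable]: "?g \<in> borel_measurable Pr"
    unfolding indicator_def greaterThanAtMost_iff by measurable
  have "(\<integral>\<^sup>+\<xi>. ?f \<xi> \<partial>Pr) = (\<integral>\<^sup>+\<xi>. (\<integral>\<^sup>+u. (\<integral>\<^sup>+w. (\<integral>\<^sup>+s. ?f (\<xi>(n := (u, w, s))) \<partial>exp_dist \<mu>) \<partial>F) \<partial>exp_dist \<Lambda>) \<partial>Pr)"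
    by (rule resample[OF \<Lambda>_pos \<mu>_pos real_distribution_F]) measurable
  also have "\<dots> = (\<integral>\<^sup>+\<xi>. (\<integral>\<^sup>+u. (\<integral>\<^sup>+w. (\<integral>\<^sup>+s. ?g (\<xi>(n := (u, w, s))) \<partial>exp_dist \<mu>) \<partial>F) \<partial>exp_dist \<Lambda>) \<partial>Pr)"
  proof (rule nn_integral_cong_AE, use AE_pos in eventually_elim)
    case (elim \<xi>)
    show ?case
    proof (rule nn_integral_cong_AE, use AE_exp_dist_pos[OF \<Lambda>_pos] in eventually_elim)
      case (elim u)
      show ?case
      proof (rule nn_integral_cong)
        fix w
        let ?\<xi> = "\<lambda>s. \<xi>(n := (u, w, s))" and ?a = "T \<xi> n - fst (\<xi> n) + u"
        \<comment> \<open>The outcome of the sale is the same for all positive service times; 1 is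
          an arbitrary representative.\<close>
        define b where "b = sold (?\<xi> 1) n"
        define \<psi> where "\<psi> s = (if b then z (?a + s) (hist (?\<xi> s) (?a + s)) else 0)" for s
        have sold: "sold (?\<xi> s) n = b" if "0 < s" for s
          using hist_service_cong[OF \<open>pos \<xi>\<close> \<open>0 < u\<close> \<open>0 < s\<close>, of 1 ?a n w]  that
          by (simp add: b_def sold_def arrival_time_upd wtp_upd)
        have a: "T (?\<xi> s) n = ?a" "departure (?\<xi> s) n = ?a + s" for s
          by (simp_all add: arrival_time_upd departure_def service_time_upd)
        have [measurable]: "\<psi> \<in> borel_measurable borel"
          unfolding \<psi>_def by measurable
        have "(\<integral>\<^sup>+s. ?f (?\<xi> s) \<partial>exp_dist \<mu>) = (\<integral>\<^sup>+s. \<psi> s \<partial>exp_dist \<mu>)"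
          by (rule nn_integral_cong_AE, use AE_exp_dist_pos[OF \<mu>_pos] in eventually_elim)
             (simp only: a sold \<psi>_def)
        also have "\<dots> = (\<integral>\<^sup>+s. (\<integral>\<^sup>+v. ennreal \<mu> * \<psi> v * indicator {0<..s} v \<partial>lborel) \<partial>exp_dist \<mu>)"
          by (rule exponential_clock[OF \<mu>_pos]) measurable
        also have "\<dots> = (\<integral>\<^sup>+s. ?g (?\<xi> s) \<partial>exp_dist \<mu>)"
        proof (rule nn_integral_cong_AE, use AE_exp_dist_pos[OF \<mu>_pos] in eventually_elim)
          case (elim s)
          have "(\<integral>\<^sup>+t. ennreal \<mu> * z t (hist (?\<xi> s) t) * indicator {?a<..?a + s} t \<partial>lborel)
              = (\<integral>\<^sup>+v. ennreal \<mu> * z (?a + v) (hist (?\<xi> s) (?a + v)) * indicator {?a<..?a + s} (?a + v) \<partial>lborel)"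
            by (rule nn_integral_lborel_shift) measurable
          also have "\<dots> = (\<integral>\<^sup>+v. ennreal \<mu> * z (?a + v) (hist (?\<xi> v) (?a + v)) * indicator {0<..s} v \<partial>lborel)"
          proof (rule nn_integral_cong)
            fix v
            show "ennreal \<mu> * z (?a + v) (hist (?\<xi> s) (?a + v)) * indicator {?a<..?a + s} (?a + v)
                = ennreal \<mu> * z (?a + v) (hist (?\<xi> v) (?a + v)) * indicator {0<..s} v"
            proof (cases "0 < v \<and> v \<le> s")
              case True
              then have "hist (?\<xi> s) (?a + v) = hist (?\<xi> v) (?a + v)"
                using \<open>0 < s\<close> by (intro hist_service_cong[OF \<open>pos \<xi>\<close> \<open>0 < u\<close>]) auto
              with True show ?thesis by simp
            qed (auto split: split_indicator)
          qed
          finally have *: "(\<integral>\<^sup>+t. ennreal \<mu> * z t (hist (?\<xi> s) t) * indicator {?a<..?a + s} t \<partial>lborel) = \<dots>" .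
          show ?case
            unfolding a sold[OF elim] * by (cases b) (simp_all add: \<psi>_def)
        qed
        finally show "(\<integral>\<^sup>+s. ?f (?\<xi> s) \<partial>exp_dist \<mu>) = (\<integral>\<^sup>+s. ?g (?\<xi> s) \<partial>exp_dist \<mu>)" .
      qed
    qed
  qed
  also have "\<dots> = (\<integral>\<^sup>+\<xi>. ?g \<xi> \<partial>Pr)"
    by (rule resample[OF \<Lambda>_pos \<mu>_pos real_distribution_F, symmetric]) measurable
  finally show ?thesis .
qed

end

subsection \<open>Level crossings\<close>

text \<open>\<open>X\<close> is read just before a jump, so an arrival that finds i is an upward
  crossing and a departure that finds i + 1 is a downward one. Both sides change consistently at
  each event, which gives an induction on the number of events before t. Distinctness of all event
  times ensures that events happen one by one.\<close>

lemma card_level_crossings: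
  fixes a e :: "nat \<Rightarrow> real" and S :: "nat set" and i :: nat
  defines "X \<equiv> \<lambda>r. card {n\<in>S. a n < r \<and> r \<le> e n}"
  assumes fin: "\<And>r. finite {n\<in>S. a n < r}" and ae: "\<And>n. a n < e n"
    and inj: "inj a" "inj e" and neq: "\<And>m n. a m \<noteq> e n"
  shows "card {n\<in>S. a n < t \<and> X (a n) = i} = card {n\<in>S. e n < t \<and> X (e n) = Suc i} + of_bool (i < X t)"
proof -
  define E where "E t = a ` {n\<in>S. a n < t} \<union> e ` {n\<in>S. e n < t}" for t
  have fine: "finite {n\<in>S. e n < r}" for r
    by (rule finite_subset[OF _ fin[of r]]) (use order.strict_trans[OF ae] in blast)
  have fins: "finite {m\<in>S. a m < r \<and> r \<le> e m}" "finite {m\<in>S. a m < r \<and> X (a m) = i}"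
      "finite {m\<in>S. e m < r \<and> X (e m) = Suc i}" for r
    by (rule finite_subset[OF _ fin[of r]], blast, rule finite_subset[OF _ fin[of r]], blast,
        rule finite_subset[OF _ fine[of r]], blast)
  have finE: "finite (E t)" for t
    unfolding E_def using fin fine by auto
  show ?thesis
  proof (induction "card (E t)" arbitrary: t rule: less_induct)
    case less
    show ?case
    proof (cases "E t = {}")
      case True
      then have "\<And>n. n \<in> S \<Longrightarrow> \<not> a n < t" "\<And>n. n \<in> S \<Longrightarrow> \<not> e n < t"
        by (auto simp: E_def)
      then have "{n\<in>S. a n < t \<and> X (a n) = i} = {}" "{n\<in>S. e n < t \<and> X (e n) = Suc i} = {}"
        and X0: "{n\<in>S. a n < t \<and> t \<le> e n} = {}"
        by auto
      moreover have "X t = 0" unfolding X_def X0 by simp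
      ultimately show ?thesis by (simp only: card.empty not_less_zero of_bool_eq add_0)
    next
      case False
      \<comment> \<open>The last event before t. No other event falls between s and t, so the counts
        at t differ from those at s by this event alone.\<close>
      define s where "s = Max (E t)"
      have s: "s \<in> E t" using False finE by (simp add: s_def)
      then have "s < t" by (auto simp: E_def)
      have le: "r \<le> s" if "r \<in> E t" for r using that finE by (simp add: s_def)
      have a_le: "a m \<le> s" if "m \<in> S" "a m < t" for m using that by (intro le) (auto simp: E_def)
      have e_le: "e m \<le> s" if "m \<in> S" "e m < t" for m using that by (intro le) (auto simp: E_def)
      have "s \<notin> E s" by (auto simp: E_def)
      moreover have "E s \<subseteq> E t"
        unfolding E_def using order.strict_trans[OF _ \<open>s < t\<close>] by blast
      ultimately have "E s \<subset> E t" using s by blast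
      then have IH: "card {n\<in>S. a n < s \<and> X (a n) = i} = card {n\<in>S. e n < s \<and> X (e n) = Suc i} + of_bool (i < X s)"
        by (intro less.hyps psubset_card_mono finE)
      from s consider n where "n \<in> S" "s = a n" | n where "n \<in> S" "s = e n" by (auto simp: E_def)
      then show ?thesis
      proof cases
        case 1
        have a_iff: "a m < t \<longleftrightarrow> m = n \<or> a m < s" if "m \<in> S" for m
          using a_le[OF that] \<open>s < t\<close> 1 injD[OF inj(1), of m n] by (auto simp: less_le)
        have e_iff: "e m < t \<longleftrightarrow> e m < s" if "m \<in> S" for m
          using e_le[OF that] \<open>s < t\<close> 1 neq[of n m] by (auto simp: less_le)
        have e_iff': "t \<le> e m \<longleftrightarrow> s \<le> e m" if "m \<in> S" for m
          using e_iff[OF that] by (auto simp: not_less[symmetric])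
        have "{m\<in>S. a m < t \<and> t \<le> e m} = insert n {m\<in>S. a m < s \<and> s \<le> e m}"
        proof (rule set_eqI)
          fix m
          show "m \<in> {m\<in>S. a m < t \<and> t \<le> e m} \<longleftrightarrow> m \<in> insert n {m\<in>S. a m < s \<and> s \<le> e m}"
            using 1 a_iff[of m] e_iff'[of m] ae[of n] by (cases "m = n") auto
        qed
        moreover have "n \<notin> {m\<in>S. a m < s \<and> s \<le> e m}" using 1 by auto
        ultimately have X: "X t = Suc (X s)"
          unfolding X_def by (simp only: card_insert_disjoint[OF fins(1)] not_False_eq_True)
        have "{m\<in>S. a m < t \<and> X (a m) = i} = {m\<in>S. a m < s \<and> X (a m) = i} \<union> (if X s = i then {n} else {})"
        proof (rule set_eqI)
          fix m
          show "m \<in> {m\<in>S. a m < t \<and> X (a m) = i} \<longleftrightarrow> m \<in> {m\<in>S. a m < s \<and> X (a m) = i} \<union> (if X s = i then {n} else {})"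
            using 1 a_iff[of m] by (cases "m = n") auto
        qed
        moreover have "card ({m\<in>S. a m < s \<and> X (a m) = i} \<union> (if X s = i then {n} else {}))
            = card {m\<in>S. a m < s \<and> X (a m) = i} + of_bool (X s = i)"
          using 1 by (subst card_Un_disjoint) (auto intro: fins)
        moreover have "{m\<in>S. e m < t \<and> X (e m) = Suc i} = {m\<in>S. e m < s \<and> X (e m) = Suc i}"
          by (rule Collect_cong) (use e_iff in blast)
        ultimately have "card {m\<in>S. a m < t \<and> X (a m) = i}
            = card {m\<in>S. e m < t \<and> X (e m) = Suc i} + (of_bool (i < X s) + of_bool (X s = i))"
          using IH by (simp only: add.assoc)
        also have "of_bool (i < X s) + of_bool (X s = i) = (of_bool (i < X t) :: nat)"
          unfolding X by (simp add: less_Suc_eq)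
        finally show ?thesis .
      next
        case 2
        have e_iff: "e m < t \<longleftrightarrow> m = n \<or> e m < s" if "m \<in> S" for m
          using e_le[OF that] \<open>s < t\<close> 2 injD[OF inj(2), of m n] by (auto simp: less_le)
        have a_iff: "a m < t \<longleftrightarrow> a m < s" if "m \<in> S" for m
          using a_le[OF that] \<open>s < t\<close> 2 neq[of m n] by (auto simp: less_le)
        have e_iff': "t \<le> e m \<longleftrightarrow> m \<noteq> n \<and> s \<le> e m" if "m \<in> S" for m
          using e_iff[OF that] by (auto simp: not_less[symmetric])
        have "{m\<in>S. a m < s \<and> s \<le> e m} = insert n {m\<in>S. a m < t \<and> t \<le> e m}"
        proof (rule set_eqI)
          fix m
          show "m \<in> {m\<in>S. a m < s \<and> s \<le> e m} \<longleftrightarrow> m \<in> insert n {m\<in>S. a m < t \<and> t \<le> e m}"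
            using 2 a_iff[of m] e_iff'[of m] ae[of n] by (cases "m = n") auto
        qed
        moreover have "n \<notin> {m\<in>S. a m < t \<and> t \<le> e m}" using 2 \<open>s < t\<close> by auto
        ultimately have X: "X s = Suc (X t)"
          unfolding X_def by (simp only: card_insert_disjoint[OF fins(1)] not_False_eq_True)
        have "{m\<in>S. e m < t \<and> X (e m) = Suc i} = {m\<in>S. e m < s \<and> X (e m) = Suc i} \<union> (if X s = Suc i then {n} else {})"
        proof (rule set_eqI)
          fix m
          show "m \<in> {m\<in>S. e m < t \<and> X (e m) = Suc i} \<longleftrightarrow> m \<in> {m\<in>S. e m < s \<and> X (e m) = Suc i} \<union> (if X s = Suc i then {n} else {})"
            using 2 e_iff[of m] by (cases "m = n") auto
        qed
        moreover have "card ({m\<in>S. e m < s \<and> X (e m) = Suc i} \<union> (if X s = Suc i then {n} else {}))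
            = card {m\<in>S. e m < s \<and> X (e m) = Suc i} + of_bool (X s = Suc i)"
          using 2 by (subst card_Un_disjoint) (auto intro: fins)
        moreover have "{m\<in>S. a m < t \<and> X (a m) = i} = {m\<in>S. a m < s \<and> X (a m) = i}"
          by (rule Collect_cong) (use a_iff in blast)
        moreover have "of_bool (i < X s) = (of_bool (X s = Suc i) + of_bool (i < X t) :: nat)"
          unfolding X by (simp add: less_Suc_eq)
        ultimately show ?thesis
          using IH by (simp only: add.assoc)
      qed
    qed
  qed
qed

text \<open>Among the intervals active at t take the one that started last. All others were active
  at its start, and there were fewer than \<open>C\<close> of them.\<close>

lemma card_active_le_capacity:
  fixes a e :: "nat \<Rightarrow> real"
  assumes fin: "\<And>r. finite {n\<in>S. a n < r}" and inj: "inj a"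
    and cap: "\<And>n. n \<in> S \<Longrightarrow> card {m\<in>S. a m < a n \<and> a n \<le> e m} < C"
  shows "card {n\<in>S. a n < t \<and> t \<le> e n} \<le> C"
proof (cases "{n\<in>S. a n < t \<and> t \<le> e n} = {}")
  case False
  let ?A = "{n\<in>S. a n < t \<and> t \<le> e n}"
  have fA: "finite ?A" by (rule finite_subset[OF _ fin[of t]]) auto
  have "Max (a ` ?A) \<in> a ` ?A" using fA False by (intro Max_in) auto
  then obtain n where nA: "n \<in> ?A" and "a n = Max (a ` ?A)" by force
  then have n: "n \<in> ?A" "a m \<le> a n" if "m \<in> ?A" for m
    using fA that by (auto intro!: Max_ge)
  have "card (?A - {n}) \<le> card {m\<in>S. a m < a n \<and> a n \<le> e m}"
    using nA n(2) by (intro card_mono finite_subset[OF _ fin[of "a n"]])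
      (auto simp: less_le dest: injD[OF inj])
  also have "\<dots> < C" using nA by (intro cap) auto
  finally show ?thesis using fA nA by (simp add: card_Diff_singleton_if)
next
  case True
  then show ?thesis by (simp only: card.empty le0)
qed

lemma suminf_indicator_eq_card:
  fixes A :: "nat set"
  assumes "finite A"
  shows "(\<Sum>n. indicator A n :: ennreal) = of_nat (card A)"
  using assms by (subst suminf_finite[of A]) (auto simp: sum.If_cases indicator_def)

context loss_system
begin

definition regular :: "sample \<Rightarrow> bool" where
  "regular \<xi> \<longleftrightarrow> pos \<xi> \<and> (\<forall>t. finite {n. T \<xi> n \<le> t}) \<and> inj (departure \<xi>) \<and>
     (\<forall>m n. T \<xi> m \<noteq> departure \<xi> n)"

lemma T_minus_interarrival: "T \<xi> n - fst (\<xi> n) = (if n = 0 then 0 else T \<xi> (n - 1))"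
  by (cases n) (auto simp: arrival_time_def)

text \<open>The interarrival intervals partition the time up to the supremum of the arrival times.
  The condition that some arrival lies at or after t must stay, because explosion is excluded only
  in \<open>AE_finite_arrivals\<close>, whose proof relies on this lemma.\<close>

lemma suminf_interarrival_intervals:
  assumes "pos \<xi>"
  shows "(\<Sum>n. indicator {T \<xi> n - fst (\<xi> n)<..T \<xi> n} t :: ennreal) = indicator {t. 0 < t \<and> (\<exists>n. t \<le> T \<xi> n)} t"
proof (cases "0 < t \<and> (\<exists>n. t \<le> T \<xi> n)")
  case True
  define n where "n = (LEAST n. t \<le> T \<xi> n)"
  have n: "t \<le> T \<xi> n" unfolding n_def using True by (auto intro: LeastI_ex)
  have less: "T \<xi> m < t" if "m < n" for m
    using not_less_Least[of m "\<lambda>n. t \<le> T \<xi> n"] that by (auto simp: n_def)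
  have "indicator {T \<xi> m - fst (\<xi> m)<..T \<xi> m} t = (if m = n then 1 else 0 :: ennreal)" for m
  proof (cases m n rule: linorder_cases)
    case less
    then show ?thesis using \<open>m < n \<Longrightarrow> T \<xi> m < t\<close> by (auto simp: indicator_def)
  next
    case equal
    then show ?thesis using n True less[of "n - 1"] by (auto simp: indicator_def T_minus_interarrival)
  next
    case greater
    then have "t \<le> T \<xi> (m - 1)" using n T_le_iff[OF assms, of n "m - 1"] by auto
    then show ?thesis using greater by (auto simp: indicator_def T_minus_interarrival)
  qed
  then have "(\<Sum>m. indicator {T \<xi> m - fst (\<xi> m)<..T \<xi> m} t :: ennreal) = (\<Sum>m. if m = n then 1 else 0)"
    by simp
  also have "\<dots> = 1" by (subst suminf_finite[of "{n}"]) auto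
  finally show ?thesis using True by simp
next
  case False
  have "0 \<le> T \<xi> n - fst (\<xi> n)" for n
    using T_pos[OF assms, of "n - 1"] by (auto simp: T_minus_interarrival)
  then have "indicator {T \<xi> n - fst (\<xi> n)<..T \<xi> n} t = (0 :: ennreal)" for n
    using False by (auto simp: indicator_def) (smt (verit) \<open>0 \<le> T \<xi> n - fst (\<xi> n)\<close>)
  then show ?thesis using False by simp
qed

lemma static_loss_system: "0 \<le> l \<Longrightarrow> l \<le> \<Lambda> \<Longrightarrow> loss_system \<Lambda> \<mu> F p (\<lambda>_ _. l)"
  using \<Lambda>_pos \<mu>_pos real_distribution_F demand
  by unfold_locales (auto simp: admissible_def)

text \<open>Under the constant rate \<^term>\<open>\<Lambda>\<close> almost every arriving customer is willing to buy, so that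
  the compensator formula counts all arrivals.\<close>

lemma AE_finite_arrivals: "AE \<xi> in Pr. \<forall>t. finite {n. T \<xi> n \<le> t}"
proof -
  interpret S: loss_system C \<Lambda> \<mu> F p "\<lambda>_ _. \<Lambda>"
    using static_loss_system[of \<Lambda>] \<Lambda>_pos by simp
  have "measure F {p \<Lambda><..} = 1"
    using demand[of \<Lambda>] \<Lambda>_pos by simp
  then have F1: "AE w in F. p \<Lambda> < w"
    using F.AE_in_set_eq_1[of "{p \<Lambda><..}"] by simp
  have wtp: "AE \<xi> in Pr. p \<Lambda> < wtp \<xi> n" for n
  proof (rule AE_resample[OF \<Lambda>_pos \<mu>_pos real_distribution_F, of _ n])
    show "AE \<xi> in Pr. AE u in exp_dist \<Lambda>. AE w in F. AE s in exp_dist \<mu>. p \<Lambda> < wtp (\<xi>(n := (u, w, s))) n"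
      using F1 by (auto simp: wtp_upd elim!: eventually_mono)
  qed measurable
  have "AE \<xi> in Pr. finite {n. T \<xi> n \<le> real k}" for k :: nat
  proof -
    \<comment> \<open>With this \<open>z\<close> the sum counts the arrivals up to time k.\<close>
    define z :: "real \<Rightarrow> history \<Rightarrow> ennreal" where "z t h = indicator {..real k} t" for t h
    have zm: "case_prod z \<in> borel_measurable (borel \<Otimes>\<^sub>M history_space)"
      unfolding z_def by measurable
    have fm: "(\<lambda>\<xi>. if p \<Lambda> < wtp \<xi> n then z (T \<xi> n) (S.hist \<xi> (T \<xi> n)) else 0) \<in> borel_measurable Pr" for n
      unfolding z_def by measurable
    then have sm: "(\<lambda>\<xi>. \<Sum>n. if p \<Lambda> < wtp \<xi> n then z (T \<xi> n) (S.hist \<xi> (T \<xi> n)) else 0) \<in> borel_measurable Pr"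
      by (rule borel_measurable_suminf_order)
    have "(\<integral>\<^sup>+\<xi>. (\<Sum>n. if p \<Lambda> < wtp \<xi> n then z (T \<xi> n) (S.hist \<xi> (T \<xi> n)) else 0) \<partial>Pr)
        = (\<Sum>n. \<integral>\<^sup>+\<xi>. (\<integral>\<^sup>+t. z t (S.hist \<xi> t) * ennreal \<Lambda> * indicator {T \<xi> n - fst (\<xi> n)<..T \<xi> n} t \<partial>lborel) \<partial>Pr)"
      unfolding S.nn_integral_arrival[OF zm, symmetric]
      by (rule nn_integral_suminf) (rule fm)
    also have "\<dots> = (\<integral>\<^sup>+\<xi>. (\<Sum>n. \<integral>\<^sup>+t. z t (S.hist \<xi> t) * ennreal \<Lambda> * indicator {T \<xi> n - fst (\<xi> n)<..T \<xi> n} t \<partial>lborel) \<partial>Pr)"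
      by (rule nn_integral_suminf[symmetric])
         (unfold z_def indicator_def greaterThanAtMost_iff, measurable)
    also have "\<dots> = (\<integral>\<^sup>+\<xi>. (\<integral>\<^sup>+t. (\<Sum>n. z t (S.hist \<xi> t) * ennreal \<Lambda> * indicator {T \<xi> n - fst (\<xi> n)<..T \<xi> n} t) \<partial>lborel) \<partial>Pr)"
      by (intro nn_integral_cong nn_integral_suminf[symmetric]) (simp add: z_def)
    \<comment> \<open>At most one interarrival interval contains t, so the expected count is at most
      \<open>\<Lambda>\<close> times k, whether or not the intervals cover the half-line.\<close>
    also have "\<dots> \<le> (\<integral>\<^sup>+\<xi>. (\<integral>\<^sup>+t. ennreal \<Lambda> * indicator {0..real k} t \<partial>lborel) \<partial>Pr)"
    proof (rule nn_integral_mono_AE, use AE_pos in eventually_elim)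
      case (elim \<xi>)
      show ?case
        by (intro nn_integral_mono)
           (auto simp: suminf_interarrival_intervals[OF elim] z_def split: split_indicator)
    qed
    also have "\<dots> < \<infinity>"
      using \<Lambda>_pos
      by (simp add: nn_integral_cmult_indicator emeasure_space_1[simplified] ennreal_mult[symmetric] del: ennreal_mult)
    finally have lt: "(\<integral>\<^sup>+\<xi>. (\<Sum>n. if p \<Lambda> < wtp \<xi> n then z (T \<xi> n) (S.hist \<xi> (T \<xi> n)) else 0) \<partial>Pr) < \<infinity>" .
    then have "AE \<xi> in Pr. (\<Sum>n. if p \<Lambda> < wtp \<xi> n then z (T \<xi> n) (S.hist \<xi> (T \<xi> n)) else 0) \<noteq> \<infinity>"
      by (intro nn_integral_PInf_AE[OF sm] less_imp_neq)
    moreover have "AE \<xi> in Pr. \<forall>n. p \<Lambda> < wtp \<xi> n"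
      using wtp by (simp add: AE_all_countable)
    ultimately show ?thesis
    proof eventually_elim
      case (elim \<xi>)
      have eq: "(if p \<Lambda> < wtp \<xi> n then z (T \<xi> n) (S.hist \<xi> (T \<xi> n)) else 0) = indicator {n. T \<xi> n \<le> real k} n" for n
        using elim by (simp add: z_def indicator_def)
      have "(\<Sum>n. indicator {n. T \<xi> n \<le> real k} n :: ennreal) = emeasure (count_space UNIV) {n. T \<xi> n \<le> real k}"
        by (subst nn_integral_count_space_nat[symmetric]) (simp add: nn_integral_indicator)
      with elim eq show ?case
        by (cases "finite {n. T \<xi> n \<le> real k}") auto
    qed
  qed
  then have "AE \<xi> in Pr. \<forall>k. finite {n. T \<xi> n \<le> real k}"
    by (simp add: AE_all_countable)
  then show ?thesis
  proof eventually_elim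
    case (elim \<xi>)
    show ?case
    proof
      fix t
      obtain k :: nat where "t \<le> real k" using real_arch_simple by blast
      then show "finite {n. T \<xi> n \<le> t}"
        by (intro finite_subset[OF _ elim[rule_format, of k]]) auto
    qed
  qed
qed

lemma pred_neq:
  fixes f g :: "'a \<Rightarrow> real"
  shows "f \<in> borel_measurable M \<Longrightarrow> g \<in> borel_measurable M \<Longrightarrow> Measurable.pred M (\<lambda>x. f x \<noteq> g x)"
  unfolding pred_def by (rule borel_measurable_neq)

text \<open>With everything but the service time of customer n fixed, a coincidence involving the
  departure of n forces this service time to take one particular value, which has probability 0. The
  entry 0 in the updates below is a placeholder, as the other event times do not involve the service
  time of n.\<close>

lemma AE_regular: "AE \<xi> in Pr. regular \<xi>"
proof -
  have "AE \<xi> in Pr. T \<xi> m \<noteq> departure \<xi> n" for m n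
  proof (rule AE_resample[OF \<Lambda>_pos \<mu>_pos real_distribution_F, of _ n])
    have *: "AE s in exp_dist \<mu>. T (\<xi>(n := (u, w, s))) m \<noteq> departure (\<xi>(n := (u, w, s))) n" for \<xi> u w
      using AE_exp_dist_neq[of "T (\<xi>(n := (u, w, 0))) m - T (\<xi>(n := (u, w, 0))) n" \<mu>]
      by (rule eventually_mono) (auto simp: departure_def arrival_time_upd service_time_upd split: if_splits)
    show "AE \<xi> in Pr. AE u in exp_dist \<Lambda>. AE w in F. AE s in exp_dist \<mu>.
        T (\<xi>(n := (u, w, s))) m \<noteq> departure (\<xi>(n := (u, w, s))) n"
      by (intro AE_I2 *)
  qed (intro pred_neq T_measurable departure_measurable)
  moreover have "AE \<xi> in Pr. m \<noteq> n \<longrightarrow> departure \<xi> m \<noteq> departure \<xi> n" for m n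
  proof (rule AE_resample[OF \<Lambda>_pos \<mu>_pos real_distribution_F, of _ n])
    have *: "AE s in exp_dist \<mu>. m \<noteq> n \<longrightarrow> departure (\<xi>(n := (u, w, s))) m \<noteq> departure (\<xi>(n := (u, w, s))) n" for \<xi> u w
      using AE_exp_dist_neq[of "departure (\<xi>(n := (u, w, 0))) m - T (\<xi>(n := (u, w, 0))) n" \<mu>]
      by (rule eventually_mono) (auto simp: departure_def arrival_time_upd service_time_upd)
    show "AE \<xi> in Pr. AE u in exp_dist \<Lambda>. AE w in F. AE s in exp_dist \<mu>.
        m \<noteq> n \<longrightarrow> departure (\<xi>(n := (u, w, s))) m \<noteq> departure (\<xi>(n := (u, w, s))) n"
      by (intro AE_I2 *)
  qed (intro pred_intros_logic pred_neq departure_measurable, simp)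
  ultimately have "AE \<xi> in Pr. \<forall>m n. T \<xi> m \<noteq> departure \<xi> n \<and> (m \<noteq> n \<longrightarrow> departure \<xi> m \<noteq> departure \<xi> n)"
    by (simp add: AE_all_countable)
  with AE_pos AE_finite_arrivals show ?thesis
    by eventually_elim (auto simp: regular_def inj_def)
qed

lemma sold_iff:
  "sold \<xi> n \<longleftrightarrow> p (\<pi> (T \<xi> n) (hist \<xi> (T \<xi> n))) < wtp \<xi> n \<and> busy (T \<xi> n) (hist \<xi> (T \<xi> n)) < C"
  by (auto simp: sold_def)

text \<open>The compensator formula for the counting process of willing customers: without explosion
  the interarrival intervals fill the positive half-line.\<close>

lemma nn_integral_sum_arrivals:
  fixes z :: "real \<Rightarrow> history \<Rightarrow> ennreal"
  assumes z: "case_prod z \<in> borel_measurable (borel \<Otimes>\<^sub>M history_space)"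
  shows "(\<integral>\<^sup>+\<xi>. (\<Sum>n. if p (\<pi> (T \<xi> n) (hist \<xi> (T \<xi> n))) < wtp \<xi> n then z (T \<xi> n) (hist \<xi> (T \<xi> n)) else 0) \<partial>Pr)
    = (\<integral>\<^sup>+\<xi>. (\<integral>\<^sup>+t. z t (hist \<xi> t) * ennreal (\<pi> t (hist \<xi> t)) * indicator {0<..} t \<partial>lborel) \<partial>Pr)"
proof -
  have zm[measurable (raw)]: "(\<lambda>x. z (f x) (g x)) \<in> borel_measurable M"
    if "f \<in> M \<rightarrow>\<^sub>M borel" "g \<in> M \<rightarrow>\<^sub>M history_space" for f g and M :: "'x measure"
    using measurable_compose[OF measurable_Pair[OF that] z] by simp
  have "(\<integral>\<^sup>+\<xi>. (\<Sum>n. if p (\<pi> (T \<xi> n) (hist \<xi> (T \<xi> n))) < wtp \<xi> n then z (T \<xi> n) (hist \<xi> (T \<xi> n)) else 0) \<partial>Pr)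
      = (\<Sum>n. \<integral>\<^sup>+\<xi>. (\<integral>\<^sup>+t. z t (hist \<xi> t) * ennreal (\<pi> t (hist \<xi> t)) * indicator {T \<xi> n - fst (\<xi> n)<..T \<xi> n} t \<partial>lborel) \<partial>Pr)"
    unfolding nn_integral_arrival[OF z, symmetric]
    by (rule nn_integral_suminf) (unfold price_ext, measurable)
  also have "\<dots> = (\<integral>\<^sup>+\<xi>. (\<Sum>n. \<integral>\<^sup>+t. z t (hist \<xi> t) * ennreal (\<pi> t (hist \<xi> t)) * indicator {T \<xi> n - fst (\<xi> n)<..T \<xi> n} t \<partial>lborel) \<partial>Pr)"
    by (rule nn_integral_suminf[symmetric]) (unfold indicator_def greaterThanAtMost_iff, measurable)
  also have "\<dots> = (\<integral>\<^sup>+\<xi>. (\<integral>\<^sup>+t. (\<Sum>n. z t (hist \<xi> t) * ennreal (\<pi> t (hist \<xi> t)) * indicator {T \<xi> n - fst (\<xi> n)<..T \<xi> n} t) \<partial>lborel) \<partial>Pr)"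
    by (intro nn_integral_cong nn_integral_suminf[symmetric]) measurable
  also have "\<dots> = (\<integral>\<^sup>+\<xi>. (\<integral>\<^sup>+t. z t (hist \<xi> t) * ennreal (\<pi> t (hist \<xi> t)) * indicator {0<..} t \<partial>lborel) \<partial>Pr)"
  proof (rule nn_integral_cong_AE, use AE_regular in eventually_elim)
    case (elim \<xi>)
    have "pos \<xi>" using elim by (simp add: regular_def)
    have ex: "\<exists>n. t \<le> T \<xi> n" for t
    proof (rule ccontr)
      assume "\<nexists>n. t \<le> T \<xi> n"
      then have "{n. T \<xi> n \<le> t} = UNIV" by (auto simp: not_le less_imp_le)
      then show False using elim by (metis regular_def infinite_UNIV_nat)
    qed
    show ?case
      by (intro nn_integral_cong) (simp add: suminf_interarrival_intervals[OF \<open>pos \<xi>\<close>] ex greaterThan_def)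
  qed
  finally show ?thesis .
qed

text \<open>Service intervals overlap, and exactly \<open>busy t\<close> of them contain t. Each
  contributes the hazard rate \<open>\<mu>\<close>, which makes the departure intensity proportional
  to the occupancy.\<close>

lemma nn_integral_sum_departures:
  fixes z :: "real \<Rightarrow> history \<Rightarrow> ennreal"
  assumes z: "case_prod z \<in> borel_measurable (borel \<Otimes>\<^sub>M history_space)"
  shows "(\<integral>\<^sup>+\<xi>. (\<Sum>n. if sold \<xi> n then z (departure \<xi> n) (hist \<xi> (departure \<xi> n)) else 0) \<partial>Pr)
    = (\<integral>\<^sup>+\<xi>. (\<integral>\<^sup>+t. ennreal \<mu> * z t (hist \<xi> t) * of_nat (busy t (hist \<xi> t)) \<partial>lborel) \<partial>Pr)"
proof -
  have zm[measurable (raw)]: "(\<lambda>x. z (f x) (g x)) \<in> borel_measurable M"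
    if "f \<in> M \<rightarrow>\<^sub>M borel" "g \<in> M \<rightarrow>\<^sub>M history_space" for f g and M :: "'x measure"
    using measurable_compose[OF measurable_Pair[OF that] z] by simp
  let ?g = "\<lambda>\<xi> n t. (if sold \<xi> n \<and> T \<xi> n < t \<and> t \<le> departure \<xi> n then ennreal \<mu> * z t (hist \<xi> t) else 0)"
  have "(\<integral>\<^sup>+\<xi>. (\<Sum>n. if sold \<xi> n then z (departure \<xi> n) (hist \<xi> (departure \<xi> n)) else 0) \<partial>Pr)
      = (\<Sum>n. \<integral>\<^sup>+\<xi>. (if sold \<xi> n then z (departure \<xi> n) (hist \<xi> (departure \<xi> n)) else 0) \<partial>Pr)"
    by (rule nn_integral_suminf) measurable
  also have "\<dots> = (\<Sum>n. \<integral>\<^sup>+\<xi>. (\<integral>\<^sup>+t. ?g \<xi> n t \<partial>lborel) \<partial>Pr)"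
    unfolding nn_integral_departure[OF z]
    by (intro arg_cong[where f=suminf] ext nn_integral_cong) (auto intro!: nn_integral_cong simp: indicator_def)
  also have "\<dots> = (\<integral>\<^sup>+\<xi>. (\<Sum>n. \<integral>\<^sup>+t. ?g \<xi> n t \<partial>lborel) \<partial>Pr)"
    by (rule nn_integral_suminf[symmetric]) measurable
  also have "\<dots> = (\<integral>\<^sup>+\<xi>. (\<integral>\<^sup>+t. (\<Sum>n. ?g \<xi> n t) \<partial>lborel) \<partial>Pr)"
    by (intro nn_integral_cong nn_integral_suminf[symmetric]) measurable
  also have "\<dots> = (\<integral>\<^sup>+\<xi>. (\<integral>\<^sup>+t. ennreal \<mu> * z t (hist \<xi> t) * of_nat (busy t (hist \<xi> t)) \<partial>lborel) \<partial>Pr)"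
  proof (rule nn_integral_cong_AE, use AE_regular in eventually_elim)
    case (elim \<xi>)
    then have "pos \<xi>" by (simp add: regular_def)
    show ?case
    proof (rule nn_integral_cong)
      fix t
      let ?A = "{n. sold \<xi> n \<and> T \<xi> n < t \<and> t \<le> departure \<xi> n}"
      have "finite {n. T \<xi> n \<le> t}" using elim by (simp add: regular_def)
      then have fin: "finite ?A" by (rule rev_finite_subset) auto
      have "(\<Sum>n. ?g \<xi> n t) = (\<Sum>n. ennreal \<mu> * z t (hist \<xi> t) * indicator ?A n)"
        by (intro arg_cong[where f=suminf] ext) (simp add: indicator_def)
      also have "\<dots> = ennreal \<mu> * z t (hist \<xi> t) * of_nat (card ?A)"
        by (simp add: suminf_indicator_eq_card[OF fin])
      finally show "(\<Sum>n. ?g \<xi> n t) = ennreal \<mu> * z t (hist \<xi> t) * of_nat (busy t (hist \<xi> t))"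
        by (simp add: busy_hist[OF \<open>pos \<xi>\<close>])
    qed
  qed
  finally show ?thesis .
qed

lemma regular_crossings:
  assumes "regular \<xi>"
  shows "card {n. sold \<xi> n \<and> T \<xi> n < t \<and> busy (T \<xi> n) (hist \<xi> (T \<xi> n)) = i}
    = card {n. sold \<xi> n \<and> departure \<xi> n < t \<and> busy (departure \<xi> n) (hist \<xi> (departure \<xi> n)) = Suc i}
      + of_bool (i < busy t (hist \<xi> t))"
proof -
  have "pos \<xi>" using assms by (simp add: regular_def)
  have fin: "finite {n \<in> Collect (sold \<xi>). T \<xi> n < r}" for r
    by (rule finite_subset[of _ "{n. T \<xi> n \<le> r}"]) (use assms in \<open>auto simp: regular_def\<close>)
  have "inj (T \<xi>)" using T_mono_strict[OF \<open>pos \<xi>\<close>] by (rule strict_mono_imp_inj_on)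
  moreover have "inj (departure \<xi>)" "T \<xi> m \<noteq> departure \<xi> n" for m n
    using assms by (auto simp: regular_def)
  ultimately show ?thesis
    using card_level_crossings[of "Collect (sold \<xi>)" "T \<xi>" "departure \<xi>" t i, OF fin departure_gt[OF \<open>pos \<xi>\<close>]]
    unfolding busy_hist[OF \<open>pos \<xi>\<close>] mem_Collect_eq by blast
qed

lemma busy_le_capacity:
  assumes "regular \<xi>"
  shows "busy t (hist \<xi> t) \<le> C"
proof -
  have "pos \<xi>" using assms by (simp add: regular_def)
  have fin: "finite {n \<in> Collect (sold \<xi>). T \<xi> n < r}" for r
    by (rule finite_subset[of _ "{n. T \<xi> n \<le> r}"]) (use assms in \<open>auto simp: regular_def\<close>)
  have "inj (T \<xi>)" using T_mono_strict[OF \<open>pos \<xi>\<close>] by (rule strict_mono_imp_inj_on)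
  moreover have "busy (T \<xi> n) (hist \<xi> (T \<xi> n)) < C" if "n \<in> Collect (sold \<xi>)" for n
    using that by (simp add: sold_def)
  ultimately show ?thesis
    using card_active_le_capacity[of "Collect (sold \<xi>)" "T \<xi>" "departure \<xi>" C t, OF fin]
    unfolding busy_hist[OF \<open>pos \<xi>\<close>] mem_Collect_eq by blast
qed

text \<open>Expectation of \<open>regular_crossings\<close>, with both counts replaced by their
  compensators. Since i < C, every willing customer who finds i occupied units is served, so upward
  crossings are counted by willingness alone.\<close>

lemma level_balance:
  assumes "i < C"
  shows "(\<integral>\<^sup>+\<xi>. (\<integral>\<^sup>+t. (if 0 < t \<and> t < R \<and> busy t (hist \<xi> t) = i then ennreal (\<pi> t (hist \<xi> t)) else 0) \<partial>lborel) \<partial>Pr)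
    = (\<integral>\<^sup>+\<xi>. (\<integral>\<^sup>+t. (if 0 < t \<and> t < R \<and> busy t (hist \<xi> t) = Suc i then ennreal (\<mu> * Suc i) else 0) \<partial>lborel) \<partial>Pr)
      + emeasure Pr {\<xi>. i < busy R (hist \<xi> R)}" (is "?L = ?R + ?E")
proof -
  define z where "z j t h = (if t < R \<and> busy t h = j then 1 else 0 :: ennreal)" for j t h
  have zm: "case_prod (z j) \<in> borel_measurable (borel \<Otimes>\<^sub>M history_space)" for j
    unfolding z_def case_prod_beta' by measurable
  have fin: "finite {n. T \<xi> n < R}" if "regular \<xi>" for \<xi>
    by (rule finite_subset[of _ "{n. T \<xi> n \<le> R}"]) (use that in \<open>auto simp: regular_def\<close>)
  have "?L = (\<integral>\<^sup>+\<xi>. (\<integral>\<^sup>+t. z i t (hist \<xi> t) * ennreal (\<pi> t (hist \<xi> t)) * indicator {0<..} t \<partial>lborel) \<partial>Pr)"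
    by (intro nn_integral_cong) (auto simp: z_def indicator_def)
  also have "\<dots> = (\<integral>\<^sup>+\<xi>. (\<Sum>n. if p (\<pi> (T \<xi> n) (hist \<xi> (T \<xi> n))) < wtp \<xi> n then z i (T \<xi> n) (hist \<xi> (T \<xi> n)) else 0) \<partial>Pr)"
    by (rule nn_integral_sum_arrivals[OF zm, symmetric])
  also have "\<dots> = (\<integral>\<^sup>+\<xi>. (\<Sum>n. if sold \<xi> n then z (Suc i) (departure \<xi> n) (hist \<xi> (departure \<xi> n)) else 0)
      + indicator {\<xi>. i < busy R (hist \<xi> R)} \<xi> \<partial>Pr)"
  proof (rule nn_integral_cong_AE, use AE_regular in eventually_elim)
    case (elim \<xi>)
    let ?U = "{n. sold \<xi> n \<and> T \<xi> n < R \<and> busy (T \<xi> n) (hist \<xi> (T \<xi> n)) = i}"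
    let ?D = "{n. sold \<xi> n \<and> departure \<xi> n < R \<and> busy (departure \<xi> n) (hist \<xi> (departure \<xi> n)) = Suc i}"
    have "pos \<xi>" using elim by (simp add: regular_def)
    have finU: "finite ?U" by (rule finite_subset[OF _ fin[OF elim]]) auto
    have finD: "finite ?D"
      by (rule finite_subset[OF _ fin[OF elim]]) (use order.strict_trans[OF departure_gt[OF \<open>pos \<xi>\<close>]] in blast)
    have "(\<Sum>n. if p (\<pi> (T \<xi> n) (hist \<xi> (T \<xi> n))) < wtp \<xi> n then z i (T \<xi> n) (hist \<xi> (T \<xi> n)) else 0)
        = (\<Sum>n. indicator ?U n)"
      using \<open>i < C\<close> by (intro arg_cong[where f=suminf] ext) (auto simp: z_def sold_iff indicator_def)
    also have "\<dots> = of_nat (card ?U)" by (rule suminf_indicator_eq_card[OF finU])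
    also have "card ?U = card ?D + of_bool (i < busy R (hist \<xi> R))" by (rule regular_crossings[OF elim])
    also have "of_nat \<dots> = (\<Sum>n. indicator ?D n) + (indicator {\<xi>. i < busy R (hist \<xi> R)} \<xi> :: ennreal)"
      unfolding suminf_indicator_eq_card[OF finD] by (simp add: indicator_def)
    also have "(\<Sum>n. indicator ?D n :: ennreal) = (\<Sum>n. if sold \<xi> n then z (Suc i) (departure \<xi> n) (hist \<xi> (departure \<xi> n)) else 0)"
      by (intro arg_cong[where f=suminf] ext) (auto simp: z_def indicator_def)
    finally show ?case .
  qed
  also have "\<dots> = (\<integral>\<^sup>+\<xi>. (\<Sum>n. if sold \<xi> n then z (Suc i) (departure \<xi> n) (hist \<xi> (departure \<xi> n)) else 0) \<partial>Pr) + ?E"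
  proof (subst nn_integral_add)
    show "(\<lambda>\<xi>. \<Sum>n. if sold \<xi> n then z (Suc i) (departure \<xi> n) (hist \<xi> (departure \<xi> n)) else 0) \<in> borel_measurable Pr"
      unfolding z_def by measurable
    have *: "{\<xi>. i < busy R (hist \<xi> R)} \<in> sets Pr"
    proof -
      have "{\<xi>\<in>space Pr. i < busy R (hist \<xi> R)} \<in> sets Pr" by measurable
      then show ?thesis by simp
    qed
    then show "indicator {\<xi>. i < busy R (hist \<xi> R)} \<in> borel_measurable Pr" by simp
    show "(\<integral>\<^sup>+\<xi>. (\<Sum>n. if sold \<xi> n then z (Suc i) (departure \<xi> n) (hist \<xi> (departure \<xi> n)) else 0) \<partial>Pr)
        + (\<integral>\<^sup>+\<xi>. indicator {\<xi>. i < busy R (hist \<xi> R)} \<xi> \<partial>Pr)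
      = (\<integral>\<^sup>+\<xi>. (\<Sum>n. if sold \<xi> n then z (Suc i) (departure \<xi> n) (hist \<xi> (departure \<xi> n)) else 0) \<partial>Pr) + ?E"
      using * by (simp add: nn_integral_indicator)
  qed
  also have "(\<integral>\<^sup>+\<xi>. (\<Sum>n. if sold \<xi> n then z (Suc i) (departure \<xi> n) (hist \<xi> (departure \<xi> n)) else 0) \<partial>Pr)
      = (\<integral>\<^sup>+\<xi>. (\<integral>\<^sup>+t. ennreal \<mu> * z (Suc i) t (hist \<xi> t) * of_nat (busy t (hist \<xi> t)) \<partial>lborel) \<partial>Pr)"
    by (rule nn_integral_sum_departures[OF zm])
  also have "\<dots> = ?R"
  proof (rule nn_integral_cong_AE, use AE_regular in eventually_elim)
    case (elim \<xi>)
    then have "pos \<xi>" by (simp add: regular_def)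
    \<comment> \<open>The departure formula integrates over all real t; a positive occupancy
      restricts this to positive times, since all arrivals are positive.\<close>
    have "0 < t" if "0 < busy t (hist \<xi> t)" for t
    proof (rule ccontr)
      assume "\<not> 0 < t"
      then have no: "{n. sold \<xi> n \<and> T \<xi> n < t \<and> t \<le> departure \<xi> n} = {}"
        using order.strict_trans[OF T_pos[OF \<open>pos \<xi>\<close>], of _ t] by blast
      then show False using that unfolding busy_hist[OF \<open>pos \<xi>\<close>] no by simp
    qed
    moreover have "ennreal \<mu> * of_nat (Suc i) = ennreal (\<mu> * Suc i)"
      using \<mu>_pos by (simp only: ennreal_of_nat_eq_real_of_nat ennreal_mult'')
    ultimately show ?case
      by (intro nn_integral_cong) (auto simp: z_def simp del: of_nat_Suc)
  qed
  finally show ?thesis .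
qed

end

subsection \<open>Time averages\<close>

text \<open>Bounded predictable quantities: functions of the time and of the history before it. On
  this class, closed under sums and products, the averages below are finite and linear.\<close>

definition bounded_functional :: "(real \<Rightarrow> history \<Rightarrow> real) \<Rightarrow> bool" where
  "bounded_functional z \<longleftrightarrow> case_prod z \<in> borel_measurable (borel \<Otimes>\<^sub>M history_space) \<and> (\<exists>K. \<forall>t h. \<bar>z t h\<bar> \<le> K)"

lemma bounded_functionalI:
  "case_prod z \<in> borel_measurable (borel \<Otimes>\<^sub>M history_space) \<Longrightarrow> (\<And>t h. \<bar>z t h\<bar> \<le> K) \<Longrightarrow> bounded_functional z"
  by (auto simp: bounded_functional_def)

lemma bounded_functional_add:
  assumes "bounded_functional y" "bounded_functional z"
  shows "bounded_functional (\<lambda>t h. y t h + z t h)"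
proof -
  obtain K L where "\<And>t h. \<bar>y t h\<bar> \<le> K" "\<And>t h. \<bar>z t h\<bar> \<le> L"
    using assms by (auto simp: bounded_functional_def)
  then have "\<bar>y t h + z t h\<bar> \<le> K + L" for t h
    by (meson abs_triangle_ineq add_mono order_trans)
  then show ?thesis
    using assms by (intro bounded_functionalI) (auto simp: bounded_functional_def case_prod_beta')
qed

lemma bounded_functional_mult:
  assumes "bounded_functional y" "bounded_functional z"
  shows "bounded_functional (\<lambda>t h. y t h * z t h)"
proof -
  obtain K L where "\<And>t h. \<bar>y t h\<bar> \<le> K" "\<And>t h. \<bar>z t h\<bar> \<le> L"
    using assms by (auto simp: bounded_functional_def)
  then have "\<bar>y t h * z t h\<bar> \<le> K * L" for t h
    by (simp add: abs_mult mult_mono' order_trans[OF abs_ge_zero])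
  then show ?thesis
    using assms by (intro bounded_functionalI) (auto simp: bounded_functional_def case_prod_beta')
qed

lemma bounded_functional_const: "bounded_functional (\<lambda>t h. k)"
  by (rule bounded_functionalI[of _ "\<bar>k\<bar>"]) auto

lemma bounded_functional_busy: "bounded_functional (\<lambda>t h. of_bool (B (busy t h)))"
proof (rule bounded_functionalI[of _ 1])
  have "(\<lambda>x. busy (fst x) (snd x)) \<in> borel \<Otimes>\<^sub>M history_space \<rightarrow>\<^sub>M count_space UNIV"
    by measurable
  moreover have "(\<lambda>k. of_bool (B k) :: real) \<in> count_space UNIV \<rightarrow>\<^sub>M borel" by simp
  ultimately show "case_prod (\<lambda>t h. of_bool (B (busy t h)) :: real) \<in> borel_measurable (borel \<Otimes>\<^sub>M history_space)"
    unfolding case_prod_beta' by (rule measurable_compose)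
qed auto

context loss_system
begin

lemma bounded_functional_rate: "bounded_functional \<pi>"
  by (rule bounded_functionalI[of _ \<Lambda>]) (use \<pi>_bounds in \<open>auto simp: abs_le_iff intro: order_trans\<close>)

text \<open>By monotonicity every posted price lies between \<open>p \<Lambda>\<close> and
  \<open>p 0\<close>.\<close>

lemma bounded_functional_price: "bounded_functional (\<lambda>t h. p (\<pi> t h))"
proof (rule bounded_functionalI[of _ "max \<bar>p 0\<bar> \<bar>p \<Lambda>\<bar>"])
  show "case_prod (\<lambda>t h. p (\<pi> t h)) \<in> borel_measurable (borel \<Otimes>\<^sub>M history_space)"
    unfolding price_ext case_prod_beta' by measurable
  fix t h
  show "\<bar>p (\<pi> t h)\<bar> \<le> max \<bar>p 0\<bar> \<bar>p \<Lambda>\<bar>"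
    using price_antimono[of 0 "\<pi> t h"] price_antimono[of "\<pi> t h" \<Lambda>] \<pi>_bounds[of t h] by auto
qed

text \<open>A time average is encoded as an expectation at an independent uniform time in [0, R], so
  that averages over samples and over time form a single integral with respect to a probability
  measure.\<close>

definition unif :: "real \<Rightarrow> real measure" where
  "unif R = uniform_measure lborel {0..R}"

definition avg :: "real \<Rightarrow> (real \<Rightarrow> history \<Rightarrow> real) \<Rightarrow> real" where
  "avg R z = (\<integral>x. z (snd x) (hist (fst x) (snd x)) \<partial>(Pr \<Otimes>\<^sub>M unif R))"

lemma sets_unif [measurable_cong, simp]: "sets (unif R) = sets borel"
  by (simp add: unif_def)

lemma prob_space_unif: "0 < R \<Longrightarrow> prob_space (unif R)"
  unfolding unif_def by (rule prob_space_uniform_measure) auto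

lemma prob_space_pair_unif:
  assumes "0 < R"
  shows "prob_space (Pr \<Otimes>\<^sub>M unif R)"
  by (rule prob_space_pair[OF prob_space_axioms prob_space_unif[OF assms]])

lemma bounded_functional_hist_measurable:
  assumes "bounded_functional z" "f \<in> M \<rightarrow>\<^sub>M Pr" "g \<in> M \<rightarrow>\<^sub>M borel"
  shows "(\<lambda>x. z (g x) (hist (f x) (g x))) \<in> borel_measurable M"
  using measurable_compose[OF measurable_Pair[OF assms(3) hist_measurable[OF assms(2,3)]], of "case_prod z"] assms(1)
  by (simp add: bounded_functional_def)

lemma integrable_avg:
  assumes "0 < R" and z: "bounded_functional z"
  shows "integrable (Pr \<Otimes>\<^sub>M unif R) (\<lambda>x. z (snd x) (hist (fst x) (snd x)))"
proof -
  interpret PU: prob_space "Pr \<Otimes>\<^sub>M unif R" by (rule prob_space_pair_unif[OF \<open>0 < R\<close>])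
  obtain K where "\<And>t h. \<bar>z t h\<bar> \<le> K" using z by (auto simp: bounded_functional_def)
  moreover have "snd \<in> Pr \<Otimes>\<^sub>M unif R \<rightarrow>\<^sub>M borel"
    by measurable
  ultimately show ?thesis
    using bounded_functional_hist_measurable[OF z measurable_fst, of snd "unif R"]
    by (intro PU.integrable_const_bound[of _ K]) auto
qed

lemma avg_add:
  assumes "0 < R" "bounded_functional y" "bounded_functional z"
  shows "avg R (\<lambda>t h. y t h + z t h) = avg R y + avg R z"
  unfolding avg_def using assms by (intro Bochner_Integration.integral_add integrable_avg)

lemma avg_cmult: "avg R (\<lambda>t h. k * z t h) = k * avg R z"
  unfolding avg_def by simp

lemma avg_mono:
  assumes "0 < R" "bounded_functional y" "bounded_functional z" "\<And>t h. y t h \<le> z t h"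
  shows "avg R y \<le> avg R z"
  unfolding avg_def using assms by (intro integral_mono integrable_avg) auto

lemma avg_const: "0 < R \<Longrightarrow> avg R (\<lambda>t h. k) = k"
  unfolding avg_def using prob_space.prob_space[OF prob_space_pair_unif[of R]] by simp

lemma avg_nonneg: "0 < R \<Longrightarrow> bounded_functional z \<Longrightarrow> (\<And>t h. 0 \<le> z t h) \<Longrightarrow> 0 \<le> avg R z"
  using avg_mono[of R "\<lambda>t h. 0" z] avg_const[of R 0] bounded_functional_const by simp

lemma avg_sum:
  assumes "0 < R" "\<And>i. i \<in> I \<Longrightarrow> bounded_functional (z i)"
  shows "avg R (\<lambda>t h. \<Sum>i\<in>I. z i t h) = (\<Sum>i\<in>I. avg R (z i))"
  unfolding avg_def using assms by (intro Bochner_Integration.integral_sum integrable_avg) auto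

lemma nn_integral_avg:
  assumes R: "0 < R" and z: "bounded_functional z" and nn: "\<And>t h. 0 \<le> z t h"
  shows "(\<integral>\<^sup>+\<xi>. (\<integral>\<^sup>+t. ennreal (z t (hist \<xi> t)) * indicator {0..R} t \<partial>lborel) \<partial>Pr) = ennreal (R * avg R z)"
proof -
  interpret U: prob_space "unif R" by (rule prob_space_unif[OF R])
  have zU[measurable]: "(\<lambda>x. z (snd x) (hist (fst x) (snd x))) \<in> borel_measurable (Pr \<Otimes>\<^sub>M unif R)"
    using integrable_avg[OF R z] by (rule borel_measurable_integrable)
  have zt[measurable]: "(\<lambda>t. z t (hist \<xi> t)) \<in> borel_measurable borel" for \<xi>
    by (rule bounded_functional_hist_measurable[OF z]) auto
  have zL[measurable]: "(\<lambda>x. z (snd x) (hist (fst x) (snd x))) \<in> borel_measurable (Pr \<Otimes>\<^sub>M lborel)"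
    by (rule bounded_functional_hist_measurable[OF z]) auto
  have "ennreal (avg R z) = (\<integral>\<^sup>+x. ennreal (z (snd x) (hist (fst x) (snd x))) \<partial>(Pr \<Otimes>\<^sub>M unif R))"
    unfolding avg_def using nn by (subst nn_integral_eq_integral) (auto intro: integrable_avg[OF R z])
  also have "\<dots> = (\<integral>\<^sup>+\<xi>. (\<integral>\<^sup>+t. ennreal (z t (hist \<xi> t)) \<partial>unif R) \<partial>Pr)"
    by (subst U.nn_integral_fst[symmetric]) auto
  also have "\<dots> = (\<integral>\<^sup>+\<xi>. (\<integral>\<^sup>+t. ennreal (z t (hist \<xi> t)) * indicator {0..R} t \<partial>lborel) / ennreal R \<partial>Pr)"
    unfolding unif_def using R by (intro nn_integral_cong) (subst nn_integral_uniform_measure, auto)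
  also have "\<dots> = (\<integral>\<^sup>+\<xi>. (\<integral>\<^sup>+t. ennreal (z t (hist \<xi> t)) * indicator {0..R} t \<partial>lborel) \<partial>Pr) / ennreal R"
    by (rule nn_integral_divide) measurable
  finally have "ennreal (avg R z) * ennreal R
      = (\<integral>\<^sup>+\<xi>. (\<integral>\<^sup>+t. ennreal (z t (hist \<xi> t)) * indicator {0..R} t \<partial>lborel) \<partial>Pr)"
    using R by (simp add: ennreal_divide_times ennreal_divide_self)
  then show ?thesis
    using R avg_nonneg[OF R z nn] by (simp add: ennreal_mult' mult.commute[of R])
qed

text \<open>The capacity bound fails for arbitrary histories h and holds only almost surely along
  trajectories. It therefore enters as an average, not as a pointwise inequality.\<close>

lemma avg_busy_le_capacity:
  assumes "0 < R"
  shows "avg R (\<lambda>t h. of_bool (busy t h \<le> C)) = 1"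
proof -
  have "ennreal (R * avg R (\<lambda>t h. of_bool (busy t h \<le> C)))
      = (\<integral>\<^sup>+\<xi>. (\<integral>\<^sup>+t. ennreal (of_bool (busy t (hist \<xi> t) \<le> C)) * indicator {0..R} t \<partial>lborel) \<partial>Pr)"
    by (rule nn_integral_avg[symmetric, OF assms bounded_functional_busy]) simp
  also have "\<dots> = (\<integral>\<^sup>+\<xi>. ennreal R \<partial>Pr)"
    by (rule nn_integral_cong_AE, use AE_regular in eventually_elim) (use assms in \<open>simp add: busy_le_capacity\<close>)
  also have "\<dots> = ennreal R" by (simp add: emeasure_space_1[simplified])
  finally have "ennreal (R * avg R (\<lambda>t h. of_bool (busy t h \<le> C))) = ennreal R" .
  moreover have "0 \<le> avg R (\<lambda>t h. of_bool (busy t h \<le> C))"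
    by (rule avg_nonneg[OF assms bounded_functional_busy]) simp
  ultimately show ?thesis using assms by (simp add: ennreal_inj)
qed

text \<open>The boundary term of \<open>level_balance\<close> is a probability, hence at most 1, and
  the average divides it by R.\<close>

lemma level_balance_avg:
  assumes "i < C" and R: "0 < R"
  shows "\<bar>avg R (\<lambda>t h. of_bool (busy t h = i) * \<pi> t h) - \<mu> * Suc i * avg R (\<lambda>t h. of_bool (busy t h = Suc i))\<bar> \<le> 1 / R"
proof -
  let ?y = "\<lambda>t h. of_bool (busy t h = i) * \<pi> t h" and ?z = "\<lambda>t h. \<mu> * Suc i * of_bool (busy t h = Suc i)"
  have bf: "bounded_functional ?y" "bounded_functional ?z"
    by (intro bounded_functional_mult bounded_functional_busy bounded_functional_rate bounded_functional_const)+
  have nn: "0 \<le> ?y t h" "0 \<le> ?z t h" for t h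
    using \<pi>_bounds[of t h] \<mu>_pos by auto
  have ae: "AE t in lborel. t \<noteq> 0 \<and> t \<noteq> R"
    using AE_lborel_singleton[of 0] AE_lborel_singleton[of R] by eventually_elim auto
  have "ennreal (R * avg R ?y)
    = (\<integral>\<^sup>+\<xi>. (\<integral>\<^sup>+t. (if 0 < t \<and> t < R \<and> busy t (hist \<xi> t) = i then ennreal (\<pi> t (hist \<xi> t)) else 0) \<partial>lborel) \<partial>Pr)"
    unfolding nn_integral_avg[OF R bf(1) nn(1), symmetric]
    by (rule nn_integral_cong, rule nn_integral_cong_AE, use ae in eventually_elim) (auto simp: indicator_def)
  also have "\<dots> = (\<integral>\<^sup>+\<xi>. (\<integral>\<^sup>+t. (if 0 < t \<and> t < R \<and> busy t (hist \<xi> t) = Suc i then ennreal (\<mu> * Suc i) else 0) \<partial>lborel) \<partial>Pr)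
      + emeasure Pr {\<xi>. i < busy R (hist \<xi> R)}"
    by (rule level_balance[OF \<open>i < C\<close>])
  also have "(\<integral>\<^sup>+\<xi>. (\<integral>\<^sup>+t. (if 0 < t \<and> t < R \<and> busy t (hist \<xi> t) = Suc i then ennreal (\<mu> * Suc i) else 0) \<partial>lborel) \<partial>Pr)
      = ennreal (R * avg R ?z)"
    unfolding nn_integral_avg[OF R bf(2) nn(2), symmetric]
    by (rule nn_integral_cong, rule nn_integral_cong_AE, use ae in eventually_elim) (auto simp: indicator_def)
  also have "\<dots> + emeasure Pr {\<xi>. i < busy R (hist \<xi> R)} = ennreal (R * avg R ?z + prob {\<xi>. i < busy R (hist \<xi> R)})"
    using R avg_nonneg[OF R bf(2) nn(2)] by (simp add: emeasure_eq_measure)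
  finally have "R * avg R ?y = R * avg R ?z + prob {\<xi>. i < busy R (hist \<xi> R)}"
    using R avg_nonneg[OF R bf(1) nn(1)] avg_nonneg[OF R bf(2) nn(2)] by (subst (asm) ennreal_inj) auto
  then have "avg R ?y - avg R ?z = prob {\<xi>. i < busy R (hist \<xi> R)} / R"
    using R by (simp add: field_simps)
  then have "\<bar>avg R ?y - avg R ?z\<bar> \<le> 1 / R"
    using R by (simp add: divide_right_mono)
  then show ?thesis by (simp only: avg_cmult)
qed

end

section \<open>Performance measures as time averages\<close>

lemma integral_dN_add:
  "integral_dN C p \<pi> \<xi> R (\<lambda>t. f t + g t) = integral_dN C p \<pi> \<xi> R f + integral_dN C p \<pi> \<xi> R g"
  by (simp add: integral_dN_def sum.distrib)

context loss_system
begin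

lemma rate_process_eq: "rate_process C p \<pi> \<xi> t = \<pi> t (hist \<xi> t)"
  by (simp add: rate_process_def rate_def hist_def)

lemma Q_eq: "Q C p \<pi> \<xi> t = C - busy t (hist \<xi> t)"
  by (simp add: Q_def available_eq_busy hist_def)

lemma has_bochner_integral_dN_nonneg:
  assumes R: "0 < R" and z: "bounded_functional z" and nn: "\<And>t h. 0 \<le> z t h"
  shows "has_bochner_integral Pr (\<lambda>\<xi>. integral_dN C p \<pi> \<xi> R (\<lambda>t. z t (hist \<xi> t)))
    (R * avg R (\<lambda>t h. z t h * \<pi> t h))"
proof -
  define buy where "buy \<xi> n \<longleftrightarrow> p (\<pi> (T \<xi> n) (hist \<xi> (T \<xi> n))) < wtp \<xi> n" for \<xi> n
  define A where "A \<xi> = {n. T \<xi> n \<le> R \<and> buy \<xi> n}" for \<xi>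
  define y where "y t h = ennreal (z t h) * (if t \<le> R then 1 else 0)" for t h
  have ym: "case_prod y \<in> borel_measurable (borel \<Otimes>\<^sub>M history_space)"
  proof -
    have [measurable]: "(\<lambda>x. z (fst x) (snd x)) \<in> borel_measurable (borel \<Otimes>\<^sub>M history_space)"
      using z by (simp add: bounded_functional_def case_prod_beta')
    show ?thesis unfolding y_def case_prod_beta' by measurable
  qed
  have bz: "bounded_functional (\<lambda>t h. z t h * \<pi> t h)"
    by (intro bounded_functional_mult z bounded_functional_rate)
  have [measurable]: "Measurable.pred Pr (\<lambda>\<xi>. buy \<xi> n)" for n
    unfolding buy_def price_ext by measurable
  have [measurable]: "(\<lambda>\<xi>. y (T \<xi> n) (hist \<xi> (T \<xi> n))) \<in> borel_measurable Pr" for n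
    using measurable_compose[OF measurable_Pair[OF T_measurable[of n] hist_measurable[OF measurable_ident T_measurable[of n]]] ym]
    by simp
  define S where "S \<xi> = (\<Sum>n. if buy \<xi> n then y (T \<xi> n) (hist \<xi> (T \<xi> n)) else 0)" for \<xi>
  have [measurable]: "S \<in> borel_measurable Pr"
    unfolding S_def by measurable
  have S: "ennreal (integral_dN C p \<pi> \<xi> R (\<lambda>t. z t (hist \<xi> t))) = S \<xi>" if "finite (A \<xi>)" for \<xi>
  proof -
    have "S \<xi> = (\<Sum>n\<in>A \<xi>. if buy \<xi> n then y (T \<xi> n) (hist \<xi> (T \<xi> n)) else 0)"
      unfolding S_def by (rule suminf_finite[OF that]) (auto simp: A_def y_def)
    also have "\<dots> = (\<Sum>n\<in>A \<xi>. ennreal (z (T \<xi> n) (hist \<xi> (T \<xi> n))))"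
      by (rule sum.cong) (auto simp: A_def y_def)
    also have "\<dots> = ennreal (integral_dN C p \<pi> \<xi> R (\<lambda>t. z t (hist \<xi> t)))"
      using nn by (simp add: integral_dN_def rate_process_eq A_def buy_def)
    finally show ?thesis by simp
  qed
  \<comment> \<open>A sum over an infinite index set is 0 by convention, so the integral and the
    series \<open>S\<close> differ on a null set of samples. Writing finiteness as boundedness of
    the indices uses only countable quantifiers and gives measurability on all samples.\<close>
  have eq: "integral_dN C p \<pi> \<xi> R (\<lambda>t. z t (hist \<xi> t))
      = (if \<exists>m. \<forall>n. T \<xi> n \<le> R \<and> buy \<xi> n \<longrightarrow> n < m then enn2real (S \<xi>) else 0)" for \<xi>
  proof (cases "finite (A \<xi>)")
    case True
    then have "\<exists>m. \<forall>n. T \<xi> n \<le> R \<and> buy \<xi> n \<longrightarrow> n < m"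
      by (simp add: A_def finite_nat_set_iff_bounded)
    moreover have "0 \<le> integral_dN C p \<pi> \<xi> R (\<lambda>t. z t (hist \<xi> t))"
      unfolding integral_dN_def using nn by (intro sum_nonneg)
    ultimately show ?thesis by (simp add: S[OF True, symmetric])
  next
    case False
    then have "\<not> (\<exists>m. \<forall>n. T \<xi> n \<le> R \<and> buy \<xi> n \<longrightarrow> n < m)"
      by (simp add: A_def finite_nat_set_iff_bounded)
    moreover have "integral_dN C p \<pi> \<xi> R (\<lambda>t. z t (hist \<xi> t)) = 0"
      using False by (simp add: integral_dN_def rate_process_eq A_def buy_def)
    ultimately show ?thesis by (simp only: if_False)
  qed
  show ?thesis
  proof (rule has_bochner_integral_nn_integral)
    show "(\<lambda>\<xi>. integral_dN C p \<pi> \<xi> R (\<lambda>t. z t (hist \<xi> t))) \<in> borel_measurable Pr"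
      unfolding eq by measurable
    show "AE \<xi> in Pr. 0 \<le> integral_dN C p \<pi> \<xi> R (\<lambda>t. z t (hist \<xi> t))"
      unfolding integral_dN_def using nn by (intro AE_I2 sum_nonneg)
    show "0 \<le> R * avg R (\<lambda>t h. z t h * \<pi> t h)"
      using R nn \<pi>_bounds(1) by (intro mult_nonneg_nonneg avg_nonneg bz) auto
    have "(\<integral>\<^sup>+\<xi>. ennreal (integral_dN C p \<pi> \<xi> R (\<lambda>t. z t (hist \<xi> t))) \<partial>Pr) = (\<integral>\<^sup>+\<xi>. S \<xi> \<partial>Pr)"
    proof (rule nn_integral_cong_AE, use AE_finite_arrivals in eventually_elim)
      case (elim \<xi>)
      then have "finite {n. T \<xi> n \<le> R}" by blast
      then show ?case by (intro S) (auto simp: A_def)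
    qed
    also have "\<dots> = (\<integral>\<^sup>+\<xi>. (\<integral>\<^sup>+t. y t (hist \<xi> t) * ennreal (\<pi> t (hist \<xi> t)) * indicator {0<..} t \<partial>lborel) \<partial>Pr)"
      unfolding S_def buy_def by (rule nn_integral_sum_arrivals[OF ym])
    also have "\<dots> = (\<integral>\<^sup>+\<xi>. (\<integral>\<^sup>+t. ennreal (z t (hist \<xi> t) * \<pi> t (hist \<xi> t)) * indicator {0..R} t \<partial>lborel) \<partial>Pr)"
    proof (rule nn_integral_cong, rule nn_integral_cong_AE, use AE_lborel_singleton[of 0] in eventually_elim)
      case (elim \<xi> t)
      then show ?case
        using nn[of t "hist \<xi> t"] \<pi>_bounds(1)[of t "hist \<xi> t"] by (auto simp: y_def indicator_def ennreal_mult)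
    qed
    also have "\<dots> = ennreal (R * avg R (\<lambda>t h. z t h * \<pi> t h))"
      using nn \<pi>_bounds(1) by (intro nn_integral_avg[OF R bz]) auto
    finally show "(\<integral>\<^sup>+\<xi>. ennreal (integral_dN C p \<pi> \<xi> R (\<lambda>t. z t (hist \<xi> t))) \<partial>Pr)
        = ennreal (R * avg R (\<lambda>t h. z t h * \<pi> t h))" .
  qed
qed

text \<open>Signed integrands are needed because the margin of a sale may be negative. Adding the
  bound K makes them nonnegative, and the constant is subtracted afterwards.\<close>

lemma integral_integral_dN:
  assumes R: "0 < R" and z: "bounded_functional z"
  shows "(\<integral>\<xi>. integral_dN C p \<pi> \<xi> R (\<lambda>t. z t (hist \<xi> t)) \<partial>Pr) = R * avg R (\<lambda>t h. z t h * \<pi> t h)"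
proof -
  obtain K where K: "\<And>t h. \<bar>z t h\<bar> \<le> K" using z by (auto simp: bounded_functional_def)
  have K0: "0 \<le> K" using order_trans[OF abs_ge_zero K] by blast
  define y where "y t h = z t h + K" for t h
  have y: "bounded_functional y"
    unfolding y_def by (intro bounded_functional_add z bounded_functional_const)
  have y0: "0 \<le> y t h" for t h using K[of t h] by (auto simp: y_def)
  let ?I = "\<lambda>\<xi> z. integral_dN C p \<pi> \<xi> R (\<lambda>t. z t (hist \<xi> t))"
  have "has_bochner_integral Pr (\<lambda>\<xi>. ?I \<xi> y - ?I \<xi> (\<lambda>t h. K))
      (R * avg R (\<lambda>t h. y t h * \<pi> t h) - R * avg R (\<lambda>t h. K * \<pi> t h))"
    using K0 by (intro has_bochner_integral_diff has_bochner_integral_dN_nonneg R y y0 bounded_functional_const)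
  also have "(\<lambda>\<xi>. ?I \<xi> y - ?I \<xi> (\<lambda>t h. K)) = (\<lambda>\<xi>. ?I \<xi> z)"
    by (simp add: y_def integral_dN_add)
  also have "R * avg R (\<lambda>t h. y t h * \<pi> t h) - R * avg R (\<lambda>t h. K * \<pi> t h) = R * avg R (\<lambda>t h. z t h * \<pi> t h)"
  proof -
    have "avg R (\<lambda>t h. z t h * \<pi> t h + K * \<pi> t h) = avg R (\<lambda>t h. z t h * \<pi> t h) + avg R (\<lambda>t h. K * \<pi> t h)"
      by (intro avg_add R bounded_functional_mult z bounded_functional_rate bounded_functional_const)
    then show ?thesis by (simp add: y_def distrib_right right_diff_distrib[symmetric])
  qed
  finally show ?thesis by (rule has_bochner_integral_integral_eq)
qed

lemma integral_time_integral:
  assumes R: "0 < R" and z: "bounded_functional z" and nn: "\<And>t h. 0 \<le> z t h"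
  shows "(\<integral>\<xi>. (LINT t:{0..R}|lborel. z t (hist \<xi> t)) \<partial>Pr) = R * avg R z"
proof -
  obtain K where K: "\<And>t h. \<bar>z t h\<bar> \<le> K" using z by (auto simp: bounded_functional_def)
  have zL[measurable]: "(\<lambda>x. z (snd x) (hist (fst x) (snd x))) \<in> borel_measurable (Pr \<Otimes>\<^sub>M lborel)"
    by (rule bounded_functional_hist_measurable[OF z]) auto
  have zt[measurable]: "(\<lambda>t. z t (hist \<xi> t)) \<in> borel_measurable borel" for \<xi>
    by (rule bounded_functional_hist_measurable[OF z]) auto
  define X where "X \<xi> = (\<integral>\<^sup>+t. ennreal (z t (hist \<xi> t)) * indicator {0..R} t \<partial>lborel)" for \<xi>
  have Xm[measurable]: "X \<in> borel_measurable Pr"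
    unfolding X_def by measurable
  have "X \<xi> \<le> (\<integral>\<^sup>+t. ennreal K * indicator {0..R} t \<partial>lborel)" for \<xi>
    unfolding X_def using K by (intro nn_integral_mono mult_right_mono ennreal_leI) (auto intro: order_trans[OF abs_ge_self])
  also have "(\<integral>\<^sup>+t. ennreal K * indicator {0..R} t \<partial>lborel) < \<infinity>"
    using R by (simp add: nn_integral_cmult_indicator ennreal_mult_less_top)
  finally have fin: "X \<xi> < \<infinity>" for \<xi> .
  have "(LINT t:{0..R}|lborel. z t (hist \<xi> t)) = enn2real (X \<xi>)" for \<xi>
    unfolding set_lebesgue_integral_def X_def using nn
    by (subst integral_eq_nn_integral)
       (auto intro!: arg_cong[where f=enn2real] nn_integral_cong simp: indicator_def)
  then have "(\<integral>\<xi>. (LINT t:{0..R}|lborel. z t (hist \<xi> t)) \<partial>Pr) = (\<integral>\<xi>. enn2real (X \<xi>) \<partial>Pr)"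
    by simp
  also have "\<dots> = enn2real (\<integral>\<^sup>+\<xi>. ennreal (enn2real (X \<xi>)) \<partial>Pr)"
    by (rule integral_eq_nn_integral) auto
  also have "(\<integral>\<^sup>+\<xi>. ennreal (enn2real (X \<xi>)) \<partial>Pr) = (\<integral>\<^sup>+\<xi>. X \<xi> \<partial>Pr)"
    using fin by (intro nn_integral_cong) (simp add: less_top)
  also have "\<dots> = ennreal (R * avg R z)"
    unfolding X_def by (rule nn_integral_avg[OF R z nn])
  also have "enn2real \<dots> = R * avg R z"
    using R avg_nonneg[OF R z nn] by simp
  finally show ?thesis .
qed

definition occupancy :: "real \<Rightarrow> nat \<Rightarrow> real" where
  "occupancy R i = avg R (\<lambda>t h. of_bool (busy t h = i))"

text \<open>For i < C this is the expected number of units sold per unit time to customers who find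
  exactly i units occupied.\<close>

definition sales :: "real \<Rightarrow> nat \<Rightarrow> real" where
  "sales R i = avg R (\<lambda>t h. of_bool (busy t h = i) * \<pi> t h)"

definition revenue :: "real \<Rightarrow> (real \<Rightarrow> real) \<Rightarrow> real" where
  "revenue R r = avg R (\<lambda>t h. of_bool (busy t h < C) * r (\<pi> t h))"

lemma occupancy_nonneg: "0 < R \<Longrightarrow> 0 \<le> occupancy R i"
  unfolding occupancy_def by (rule avg_nonneg[OF _ bounded_functional_busy]) auto

lemma sum_occupancy:
  assumes R: "0 < R"
  shows "(\<Sum>i\<le>C. occupancy R i) = 1"
proof -
  have "(\<Sum>i\<le>C. occupancy R i) = avg R (\<lambda>t h. \<Sum>i\<le>C. of_bool (busy t h = i))"
    unfolding occupancy_def by (rule avg_sum[OF R bounded_functional_busy, symmetric])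
  also have "(\<lambda>t h. \<Sum>i\<le>C. of_bool (busy t h = i) :: real) = (\<lambda>t h. of_bool (busy t h \<le> C))"
    by (simp add: of_bool_def)
  finally show ?thesis using avg_busy_le_capacity[OF R] by simp
qed

lemma sum_of_bool_busy: "(\<Sum>i<C. of_bool (busy t h = i) :: real) = of_bool (busy t h < C)"
  by (simp add: of_bool_def)

lemma avg_not_full: "0 < R \<Longrightarrow> avg R (\<lambda>t h. of_bool (busy t h < C)) = (\<Sum>i<C. occupancy R i)"
  unfolding occupancy_def sum_of_bool_busy[symmetric] by (rule avg_sum[OF _ bounded_functional_busy])

lemma avg_sales: "0 < R \<Longrightarrow> avg R (\<lambda>t h. of_bool (busy t h < C) * \<pi> t h) = (\<Sum>i<C. sales R i)"
  unfolding sales_def sum_of_bool_busy[symmetric] sum_distrib_right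
  by (rule avg_sum[OF _ bounded_functional_mult[OF bounded_functional_busy bounded_functional_rate]])

lemma sales_bounds:
  assumes R: "0 < R"
  shows "0 \<le> sales R i" "sales R i \<le> \<Lambda> * occupancy R i"
proof -
  have b: "bounded_functional (\<lambda>t h. of_bool (busy t h = i) * \<pi> t h)" "bounded_functional (\<lambda>t h. \<Lambda> * of_bool (busy t h = i))"
    by (intro bounded_functional_mult bounded_functional_busy bounded_functional_rate bounded_functional_const)+
  show "0 \<le> sales R i"
    unfolding sales_def by (rule avg_nonneg[OF R b(1)]) (simp add: \<pi>_bounds)
  have "sales R i \<le> avg R (\<lambda>t h. \<Lambda> * of_bool (busy t h = i))"
    unfolding sales_def by (rule avg_mono[OF R b]) (simp add: \<pi>_bounds)
  then show "sales R i \<le> \<Lambda> * occupancy R i"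
    by (simp only: avg_cmult occupancy_def)
qed

lemma sales_balance:
  assumes "0 < R" "i < C"
  shows "\<bar>sales R i - \<mu> * Suc i * occupancy R (Suc i)\<bar> \<le> 1 / R"
  unfolding sales_def occupancy_def by (rule level_balance_avg[OF assms(2,1)])

lemma bounded_functional_revenue: "bounded_functional (\<lambda>t h. \<pi> t h * (p (\<pi> t h) - c))"
  using bounded_functional_mult[OF bounded_functional_rate
      bounded_functional_add[OF bounded_functional_price bounded_functional_const[of "- c"]]]
  by simp

text \<open>The form in which concavity is used: averaging an affine majorant over the times with an
  idle unit leaves only service level and market share.\<close>

lemma revenue_le_affine:
  assumes R: "0 < R" and le: "\<And>l. 0 \<le> l \<Longrightarrow> l \<le> \<Lambda> \<Longrightarrow> l * (p l - c) \<le> k + g * l"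
  shows "revenue R (\<lambda>l. l * (p l - c)) \<le> k * (\<Sum>i<C. occupancy R i) + g * (\<Sum>i<C. sales R i)"
proof -
  have b: "bounded_functional (\<lambda>t h. k * of_bool (busy t h < C))"
      "bounded_functional (\<lambda>t h. g * (of_bool (busy t h < C) * \<pi> t h))"
      "bounded_functional (\<lambda>t h. of_bool (busy t h < C) * (\<pi> t h * (p (\<pi> t h) - c)))"
    by (intro bounded_functional_mult bounded_functional_busy bounded_functional_rate
        bounded_functional_const bounded_functional_revenue)+
  have "revenue R (\<lambda>l. l * (p l - c)) \<le> avg R (\<lambda>t h. k * of_bool (busy t h < C) + g * (of_bool (busy t h < C) * \<pi> t h))"
    unfolding revenue_def using le[OF \<pi>_bounds]
    by (intro avg_mono[OF R b(3) bounded_functional_add[OF b(1,2)]]) auto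
  also have "\<dots> = k * (\<Sum>i<C. occupancy R i) + g * (\<Sum>i<C. sales R i)"
    by (simp only: avg_add[OF R b(1,2)] avg_cmult avg_not_full[OF R] avg_sales[OF R])
  finally show ?thesis .
qed

lemma market_share_integral:
  assumes R: "0 < R"
  shows "1 / R * (\<integral>\<xi>. integral_dN C p \<pi> \<xi> R (\<lambda>t. of_bool (Q C p \<pi> \<xi> t > 0)) \<partial>Pr) = (\<Sum>i<C. sales R i)"
  using integral_integral_dN[OF R bounded_functional_busy[of "\<lambda>b. b < C"]] R
  by (simp add: Q_eq avg_sales)

lemma service_level_integral:
  assumes R: "0 < R"
  shows "1 / R * (\<integral>\<xi>. (LINT t:{0..R}|lborel. of_bool (Q C p \<pi> \<xi> t > 0)) \<partial>Pr) = (\<Sum>i<C. occupancy R i)"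
  using integral_time_integral[OF R bounded_functional_busy[of "\<lambda>b. b < C"]] R
  by (simp add: Q_eq avg_not_full)

lemma profit_rate_integral:
  assumes R: "0 < R"
  shows "1 / R * (\<integral>\<xi>. integral_dN C p \<pi> \<xi> R
      (\<lambda>t. of_bool (Q C p \<pi> \<xi> t > 0) * (p (rate_process C p \<pi> \<xi> t) - c)) \<partial>Pr)
    = revenue R (\<lambda>l. l * (p l - c))"
proof -
  have b: "bounded_functional (\<lambda>t h. of_bool (busy t h < C) * (p (\<pi> t h) - c))"
    using bounded_functional_mult[OF bounded_functional_busy
        bounded_functional_add[OF bounded_functional_price bounded_functional_const[of "- c"]]]
    by simp
  show ?thesis
    using integral_integral_dN[OF R b] R
    by (simp add: Q_eq rate_process_eq revenue_def mult_ac)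
qed

end

subsection \<open>Erlang's loss formula\<close>

text \<open>Under the weights \<^term>\<open>w k * x ^ k\<close> the likelihood ratio is monotone in \<^term>\<open>x\<close>, so that
  expectations of nondecreasing functions grow with \<^term>\<open>x\<close>.\<close>

lemma weighted_mean_mono:
  fixes f w :: "nat \<Rightarrow> real"
  assumes w: "\<And>k. 0 \<le> w k" and f: "\<And>j k. j \<le> k \<Longrightarrow> k \<le> n \<Longrightarrow> f j \<le> f k" and x: "0 \<le> x" "x \<le> y"
  shows "(\<Sum>k\<le>n. f k * (w k * x ^ k)) * (\<Sum>k\<le>n. w k * y ^ k) \<le> (\<Sum>k\<le>n. f k * (w k * y ^ k)) * (\<Sum>k\<le>n. w k * x ^ k)"
proof -
  \<comment> \<open>Antisymmetrisation: twice the difference of the two sides is the sum of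
    \<open>(f k - f j) * d k j\<close>, and both factors have the sign of k - j.\<close>
  define d where "d k j = w k * w j * (y ^ k * x ^ j - x ^ k * y ^ j)" for k j
  have anti: "d j k = - d k j" for j k by (simp add: d_def algebra_simps)
  have sgn: "0 \<le> d k j" if "j \<le> k" for j k
  proof -
    have split: "z ^ k = z ^ j * z ^ (k - j)" for z :: real
      using that by (simp flip: power_add)
    have "x ^ (k - j) \<le> y ^ (k - j)" using x by (intro power_mono) auto
    then have "x ^ j * y ^ j * x ^ (k - j) \<le> x ^ j * y ^ j * y ^ (k - j)"
      using x by (intro mult_left_mono) auto
    then have "x ^ k * y ^ j \<le> y ^ k * x ^ j"
      unfolding split by (simp only: mult_ac)
    then show ?thesis using w by (simp add: d_def)
  qed
  have "(\<Sum>k\<le>n. f k * (w k * y ^ k)) * (\<Sum>k\<le>n. w k * x ^ k) - (\<Sum>k\<le>n. f k * (w k * x ^ k)) * (\<Sum>k\<le>n. w k * y ^ k)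
      = (\<Sum>k\<le>n. \<Sum>j\<le>n. f k * d k j)"
    unfolding sum_product sum_subtractf[symmetric]
    by (intro sum.cong refl) (simp add: d_def algebra_simps)
  moreover have "2 * (\<Sum>k\<le>n. \<Sum>j\<le>n. f k * d k j) = (\<Sum>k\<le>n. \<Sum>j\<le>n. f k * d k j) + (\<Sum>k\<le>n. \<Sum>j\<le>n. f j * d j k)"
    by (subst (2) sum.swap) simp
  moreover have "\<dots> = (\<Sum>k\<le>n. \<Sum>j\<le>n. (f k - f j) * d k j)"
    unfolding sum.distrib[symmetric] by (intro sum.cong refl) (subst anti, simp add: algebra_simps)
  moreover have "0 \<le> \<dots>"
  proof (intro sum_nonneg)
    fix k j assume "k \<in> {..n}" "j \<in> {..n}"
    then show "0 \<le> (f k - f j) * d k j"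
    proof (cases "j \<le> k")
      case True
      with \<open>k \<in> {..n}\<close> show ?thesis using f[of j k] sgn[of j k] by (intro mult_nonneg_nonneg) auto
    next
      case False
      with \<open>j \<in> {..n}\<close> show ?thesis
        using f[of k j] sgn[of k j] anti[of j k] by (intro mult_nonpos_nonpos) auto
    qed
  qed
  ultimately show ?thesis by linarith
qed

text \<open>The stationary probability that an Erlang loss system with \<^term>\<open>C\<close> servers and offered load
  \<^term>\<open>x\<close> has an idle server.\<close>

definition erlang_idle :: "nat \<Rightarrow> real \<Rightarrow> real" where
  "erlang_idle C x = (\<Sum>k<C. x ^ k / fact k) / (\<Sum>k\<le>C. x ^ k / fact k)"

lemma erlang_norm_ge_1: "0 \<le> x \<Longrightarrow> 1 \<le> (\<Sum>k\<le>C. x ^ k / fact k :: real)"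
  by (subst sum.atMost_shift) (auto intro!: sum_nonneg)

text \<open>The blocking probability is the mean of the indicator of k = C, a nondecreasing function
  of k.\<close>

lemma erlang_idle_antimono:
  assumes "0 \<le> x" "x \<le> y"
  shows "erlang_idle C y \<le> erlang_idle C x"
proof -
  have *: "(\<Sum>k<C. z ^ k / fact k) = (\<Sum>k\<le>C. z ^ k / fact k) - (\<Sum>k\<le>C. of_bool (k = C) * (1 / fact k * z ^ k))" for z :: real
    by (simp add: lessThan_Suc_atMost[symmetric])
  have "0 \<le> y" using assms by simp
  have "(\<Sum>k\<le>C. of_bool (k = C) * (1 / fact k * x ^ k)) * (\<Sum>k\<le>C. 1 / fact k * y ^ k)
      \<le> (\<Sum>k\<le>C. of_bool (k = C) * (1 / fact k * y ^ k)) * (\<Sum>k\<le>C. 1 / fact k * x ^ k)"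
    by (rule weighted_mean_mono) (use assms in auto)
  moreover have "(Y - v) / Y \<le> (X - u) / X" if "u * Y \<le> v * X" "1 \<le> X" "1 \<le> Y" for u v X Y :: real
    using that by (simp add: divide_simps algebra_simps)
  ultimately show ?thesis
    unfolding erlang_idle_def *
    using erlang_norm_ge_1[OF \<open>0 \<le> x\<close>, of C] erlang_norm_ge_1[OF \<open>0 \<le> y\<close>, of C]
    by (simp only: mult_1 times_divide_eq_left)
qed

text \<open>Multiplication by x shifts the weights, x * x^k / k! = (k + 1) * x^(k+1) / (k + 1)!, so
  the product is the mean of \<open>f\<close>. This \<open>f\<close> is k + 1 below C and equals C
  at C: it is nondecreasing precisely because the factor is 1 + x, which adds 1 to all states but
  the last.\<close>

lemma erlang_idle_scaled_mono:
  assumes "0 \<le> x" "x \<le> y"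
  shows "(1 + x) * erlang_idle C x \<le> (1 + y) * erlang_idle C y"
proof -
  define f :: "nat \<Rightarrow> real" where "f k = real k + of_bool (k < C)" for k
  have num: "(1 + z) * (\<Sum>k<C. z ^ k / fact k) = (\<Sum>k\<le>C. f k * (1 / fact k * z ^ k))" for z :: real
  proof -
    have "z * (\<Sum>k<C. z ^ k / fact k) = (\<Sum>k<C. real (Suc k) * (1 / fact (Suc k) * z ^ Suc k))"
      unfolding sum_distrib_left by (intro sum.cong) (auto simp: divide_simps)
    also have "\<dots> = (\<Sum>k\<le>C. real k * (1 / fact k * z ^ k))"
      by (subst sum.atMost_shift) simp
    finally have 1: "z * (\<Sum>k<C. z ^ k / fact k) = \<dots>" .
    have 2: "(\<Sum>k<C. z ^ k / fact k) = (\<Sum>k\<le>C. of_bool (k < C) * (1 / fact k * z ^ k))"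
      by (simp add: lessThan_Suc_atMost[symmetric])
    show ?thesis
      unfolding f_def distrib_right sum.distrib 1[symmetric] 2[symmetric] by simp
  qed
  have "0 \<le> y" using assms by simp
  have "(\<Sum>k\<le>C. f k * (1 / fact k * x ^ k)) * (\<Sum>k\<le>C. 1 / fact k * y ^ k)
      \<le> (\<Sum>k\<le>C. f k * (1 / fact k * y ^ k)) * (\<Sum>k\<le>C. 1 / fact k * x ^ k)"
    by (rule weighted_mean_mono) (use assms in \<open>auto simp: f_def\<close>)
  moreover have "u / X \<le> v / Y" if "u * Y \<le> v * X" "1 \<le> X" "1 \<le> Y" for u v X Y :: real
    using that by (simp add: divide_simps algebra_simps)
  ultimately show ?thesis
    unfolding erlang_idle_def times_divide_eq_right num
    using erlang_norm_ge_1[OF \<open>0 \<le> x\<close>, of C] erlang_norm_ge_1[OF \<open>0 \<le> y\<close>, of C]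
    by (simp only: mult_1 times_divide_eq_left)
qed

text \<open>Equality holds for three servers.\<close>

lemma erlang_idle_critical:
  assumes "0 < C"
  shows "15 / 19 \<le> erlang_idle C (real C - 1)"
proof -
  let ?a = "real C - 1"
  have a: "0 \<le> ?a" using assms by simp
  \<comment> \<open>Equivalent form: the weight of the full state is at most 4/15 of the total
    weight of the others.\<close>
  have "15 * (?a ^ C / fact C) \<le> 4 * (\<Sum>k<C. ?a ^ k / fact k)"
  proof (cases "C < 6")
    case True
    with assms consider "C = 1" | "C = 2" | "C = 3" | "C = 4" | "C = 5" by linarith
    then show ?thesis
      by cases (auto simp: lessThan_nat_numeral fact_numeral power_numeral_reduce)
  next
    case False
    then obtain n where n: "C = n + 6" by (metis add.commute le_Suc_ex not_less)
    let ?m = "real n"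
    \<comment> \<open>For C = n + 6 the five weights before the last one suffice. They are expressed
      through the first of them, \<open>\<tau>\<close>; the weights at n + 4 and n + 5 coincide
      because the load is n + 5.\<close>
    define \<tau> where "\<tau> = (?m + 5) ^ (n + 1) / fact (n + 1)"
    have \<tau>: "0 < \<tau>" by (simp add: \<tau>_def)
    have a: "?a = ?m + 5" using n by simp
    have step: "(?m + 5) ^ Suc k / fact (Suc k) = (?m + 5) ^ k / fact k * ((?m + 5) / (real k + 1))" for k
      by (simp add: field_simps)
    have suc: "Suc (n + 1) = n + 2" "Suc (n + 2) = n + 3" "Suc (n + 3) = n + 4" "Suc (n + 4) = n + 5" "Suc (n + 5) = n + 6"
      by simp_all
    have ratio: "real (n + 1) + 1 = ?m + 2" "real (n + 2) + 1 = ?m + 3" "real (n + 3) + 1 = ?m + 4" "real (n + 5) + 1 = ?m + 6"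
        "(?m + 5) / (real (n + 4) + 1) = 1"
      by simp_all
    note t1 = \<tau>_def[symmetric]
    note t2 = step[of "n + 1", unfolded suc ratio t1]
    note t3 = step[of "n + 2", unfolded suc ratio t2]
    note t4 = step[of "n + 3", unfolded suc ratio t3]
    note t5 = step[of "n + 4", unfolded suc ratio t4 mult_1_right]
    note t6 = step[of "n + 5", unfolded suc ratio t5]
    let ?q = "(?m + 2) * (?m + 3) * (?m + 4) * (?m + 5) * (?m + 6)"
    \<comment> \<open>The inequality for these weights after clearing denominators. As n grows all
      ratios tend to 1, which leaves the leading coefficient 4 * 5 - 15 = 5; the other coefficients
      of the difference are positive too.\<close>
    have poly: "15 * (?m + 5) ^ 5 \<le> 4 * (?q + (?m + 5) * ((?m + 3) * (?m + 4) * (?m + 5) * (?m + 6))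
        + (?m + 5) ^ 2 * ((?m + 4) * (?m + 5) * (?m + 6)) + 2 * ((?m + 5) ^ 4 * (?m + 6)))"
    proof -
      have "4 * (?q + (?m + 5) * ((?m + 3) * (?m + 4) * (?m + 5) * (?m + 6))
        + (?m + 5) ^ 2 * ((?m + 4) * (?m + 5) * (?m + 6)) + 2 * ((?m + 5) ^ 4 * (?m + 6))) - 15 * (?m + 5) ^ 5
        = 5205 + 6781 * ?m + 3458 * ?m ^ 2 + 862 * ?m ^ 3 + 105 * ?m ^ 4 + 5 * ?m ^ 5"
        by (simp add: power_numeral_reduce algebra_simps)
      moreover have "0 \<le> \<dots>" by simp
      ultimately show ?thesis by linarith
    qed
    \<comment> \<open>Division of \<open>poly\<close> by the common denominator; a, b, c, d, e stand
      for n + 5, n + 2, n + 3, n + 4, n + 6.\<close>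
    have clear: "15 * (\<tau> * (a / b) * (a / c) * (a / d) * (a / e)) \<le> 4 * (\<tau> + \<tau> * (a / b)
        + \<tau> * (a / b) * (a / c) + \<tau> * (a / b) * (a / c) * (a / d) + \<tau> * (a / b) * (a / c) * (a / d))"
      if nz: "0 < a" "0 < b" "0 < c" "0 < d" "0 < e"
        and le: "15 * a ^ 5 \<le> 4 * (b * c * d * a * e + a * (c * d * a * e) + a ^ 2 * (d * a * e) + 2 * (a ^ 4 * e))"
      for a b c d e :: real
    proof -
      let ?k = "\<tau> / (b * c * d * a * e)"
      have "15 * (\<tau> * (a / b) * (a / c) * (a / d) * (a / e)) = ?k * (15 * a ^ 5)"
        using nz by (simp add: power_numeral_reduce mult_ac)
      also have "\<dots> \<le> ?k * (4 * (b * c * d * a * e + a * (c * d * a * e) + a ^ 2 * (d * a * e) + 2 * (a ^ 4 * e)))"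
        using \<tau> nz by (intro mult_left_mono le) simp
      also have "\<dots> = 4 * (?k * (b * c * d * a * e) + ?k * (a * (c * d * a * e)) + ?k * (a ^ 2 * (d * a * e))
          + ?k * (a ^ 4 * e) + ?k * (a ^ 4 * e))"
        by (simp only: distrib_left mult.left_commute[of _ 4] mult.left_commute[of _ 2] mult_2 add.assoc)
      also have "?k * (b * c * d * a * e) = \<tau>" using nz by simp
      also have "?k * (a * (c * d * a * e)) = \<tau> * (a / b)" using nz by simp
      also have "?k * (a ^ 2 * (d * a * e)) = \<tau> * (a / b) * (a / c)" using nz by (simp add: power2_eq_square)
      also have "?k * (a ^ 4 * e) = \<tau> * (a / b) * (a / c) * (a / d)" using nz by (simp add: power_numeral_reduce)
      finally show ?thesis .
    qed
    have "15 * (\<tau> * ((?m + 5) / (?m + 2)) * ((?m + 5) / (?m + 3)) * ((?m + 5) / (?m + 4)) * ((?m + 5) / (?m + 6)))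
        \<le> 4 * (\<tau> + \<tau> * ((?m + 5) / (?m + 2)) + \<tau> * ((?m + 5) / (?m + 2)) * ((?m + 5) / (?m + 3))
        + \<tau> * ((?m + 5) / (?m + 2)) * ((?m + 5) / (?m + 3)) * ((?m + 5) / (?m + 4))
        + \<tau> * ((?m + 5) / (?m + 2)) * ((?m + 5) / (?m + 3)) * ((?m + 5) / (?m + 4)))"
      by (rule clear[OF _ _ _ _ _ poly]) simp_all
    also have "\<dots> = 4 * (\<Sum>k\<in>{n + 1, n + 2, n + 3, n + 4, n + 5}. (?m + 5) ^ k / fact k)"
    proof -
      have "sum g {n + 1, n + 2, n + 3, n + 4, n + 5} = g (n + 1) + g (n + 2) + g (n + 3) + g (n + 4) + g (n + 5)"
        for g :: "nat \<Rightarrow> real"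
        by simp
      then show ?thesis by (simp only: t1 t2 t3 t4 t5)
    qed
    also have "\<dots> \<le> 4 * (\<Sum>k<C. (?m + 5) ^ k / fact k)"
      using n by (intro mult_left_mono sum_mono2) auto
    finally show ?thesis unfolding a t6[symmetric] n[symmetric] .
  qed
  then have "15 * ((\<Sum>k<C. ?a ^ k / fact k) + ?a ^ C / fact C) \<le> 19 * (\<Sum>k<C. ?a ^ k / fact k)"
    by simp
  moreover have "(\<Sum>k\<le>C. ?a ^ k / fact k) = (\<Sum>k<C. ?a ^ k / fact k) + ?a ^ C / fact C"
    by (simp add: lessThan_Suc_atMost[symmetric])
  ultimately show ?thesis
    unfolding erlang_idle_def using erlang_norm_ge_1[OF a, of C]
    by (simp add: pos_le_divide_eq)
qed

text \<open>The upper bounds 1 and C / (1 + x) on a cross at x = C - 1. To the left the first one is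
  compared with the decreasing idle probability, to the right the second one with its increasing
  multiple by 1 + x; both comparisons reduce to the crossing point.\<close>

lemma erlang_idle_lower_bound:
  assumes "0 < C" "0 \<le> x" "a \<le> 1" "a * (1 + x) \<le> real C"
  shows "15 / 19 * a \<le> erlang_idle C x"
proof (cases "x \<le> real C - 1")
  case True
  have "15 / 19 * a \<le> 15 / 19" using assms by simp
  also have "\<dots> \<le> erlang_idle C (real C - 1)" by (rule erlang_idle_critical[OF \<open>0 < C\<close>])
  also have "\<dots> \<le> erlang_idle C x" using assms True by (intro erlang_idle_antimono)
  finally show ?thesis .
next
  case False
  have "(15 / 19 * a) * (1 + x) \<le> 15 / 19 * real C"
    using assms(4) by simp
  also have "\<dots> \<le> (1 + (real C - 1)) * erlang_idle C (real C - 1)"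
    using mult_left_mono[OF erlang_idle_critical[OF \<open>0 < C\<close>], of "real C"] by simp
  also have "\<dots> \<le> (1 + x) * erlang_idle C x"
    using False \<open>0 < C\<close> by (intro erlang_idle_scaled_mono) auto
  finally show ?thesis
    using \<open>0 \<le> x\<close> by (simp add: mult.commute[of _ "1 + x"] del: times_divide_eq_left)
qed

section \<open>Continuity and passage to the limit\<close>

lemma continuous_on_erlang_idle: "continuous_on {0..} (erlang_idle C)"
  unfolding erlang_idle_def
proof (intro continuous_intros ballI)
  fix x :: real assume "x \<in> {0..}"
  then show "(\<Sum>k\<le>C. x ^ k / fact k) \<noteq> 0" using erlang_norm_ge_1[of x C] by auto
qed auto

text \<open>Convergence of the occupancies is derived, not assumed: by induction the deviation
  \<open>e\<close> from the Erlang weights tends to 0, and normalisation then fixes the limit of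
  \<open>occ x 0\<close>. The filter is arbitrary so that the lemma serves both large horizons and,
  as a constant sequence, exact solutions of the balance equations.\<close>

lemma erlang_limit:
  fixes occ :: "'a \<Rightarrow> nat \<Rightarrow> real"
  assumes bal: "\<And>i. i < C \<Longrightarrow> ((\<lambda>x. occ x (Suc i) - \<rho> / Suc i * occ x i) \<longlongrightarrow> 0) G"
    and one: "\<forall>\<^sub>F x in G. (\<Sum>i\<le>C. occ x i) = 1" and \<rho>: "0 \<le> \<rho>"
  shows "((\<lambda>x. \<Sum>i<C. occ x i) \<longlongrightarrow> erlang_idle C \<rho>) G"
proof -
  define D where "D = (\<Sum>i\<le>C. \<rho> ^ i / fact i)"
  have D: "0 < D" using erlang_norm_ge_1[OF \<rho>, of C] by (simp add: D_def)
  define e where "e x i = occ x i - \<rho> ^ i / fact i * occ x 0" for x i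
  have e: "i \<le> C \<Longrightarrow> ((\<lambda>x. e x i) \<longlongrightarrow> 0) G" for i
  proof (induction i)
    case 0
    show ?case by (simp add: e_def)
  next
    case (Suc i)
    have "((\<lambda>x. (occ x (Suc i) - \<rho> / Suc i * occ x i) + \<rho> / Suc i * e x i) \<longlongrightarrow> 0 + \<rho> / Suc i * 0) G"
      using Suc by (intro tendsto_intros bal) auto
    also have "(\<lambda>x. (occ x (Suc i) - \<rho> / Suc i * occ x i) + \<rho> / Suc i * e x i) = (\<lambda>x. e x (Suc i))"
      by (simp add: e_def algebra_simps)
    finally show ?case by simp
  qed
  have sum_occ: "(\<Sum>i\<in>I. occ x i) = (\<Sum>i\<in>I. e x i) + (\<Sum>i\<in>I. \<rho> ^ i / fact i) * occ x 0" for I x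
    by (simp add: e_def sum_distrib_right sum_subtractf)
  have "((\<lambda>x. (1 - (\<Sum>i\<le>C. e x i)) / D) \<longlongrightarrow> (1 - (\<Sum>i\<le>C. 0)) / D) G"
    using D by (intro tendsto_intros e) auto
  moreover have "\<forall>\<^sub>F x in G. (1 - (\<Sum>i\<le>C. e x i)) / D = occ x 0"
    using one by eventually_elim (use D in \<open>simp add: sum_occ D_def[symmetric] field_simps\<close>)
  ultimately have occ0: "((\<lambda>x. occ x 0) \<longlongrightarrow> 1 / D) G"
    by (simp add: tendsto_cong)
  have "((\<lambda>x. (\<Sum>i<C. e x i) + (\<Sum>i<C. \<rho> ^ i / fact i) * occ x 0) \<longlongrightarrow> (\<Sum>i<C. 0) + (\<Sum>i<C. \<rho> ^ i / fact i) * (1 / D)) G"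
    by (intro tendsto_intros e occ0) auto
  then show ?thesis by (simp add: sum_occ erlang_idle_def D_def)
qed

text \<open>The comparison function g admits an f without a limit along r, as happens for the
  profit.\<close>

lemma Liminf_le_subsequential_limit:
  fixes f :: "'a \<Rightarrow> ereal"
  assumes r: "filterlim r G H" and le: "\<forall>\<^sub>F x in G. f x \<le> g x" and lim: "((\<lambda>x. g (r x)) \<longlongrightarrow> L) H" and "H \<noteq> bot"
  shows "Liminf G f \<le> L"
proof (rule ccontr)
  assume "\<not> Liminf G f \<le> L"
  then obtain y where y: "L < y" "y < Liminf G f" by (meson dense not_le)
  then have "\<forall>\<^sub>F x in G. y < f x" using le_Liminf_iff[of "Liminf G f" G f] by auto
  with le have "\<forall>\<^sub>F x in G. y \<le> g x" by eventually_elim auto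
  then have "\<forall>\<^sub>F x in H. y \<le> g (r x)" by (rule eventually_compose_filterlim[OF _ r])
  then have "y \<le> L" using lim \<open>H \<noteq> bot\<close> by (intro tendsto_lowerbound)
  with y show False by simp
qed

lemma bounded_sequences_convergent_subsequence:
  fixes f :: "nat \<Rightarrow> nat \<Rightarrow> real"
  assumes "\<And>i. bounded (range (\<lambda>k. f k i))"
  shows "\<exists>r q. strict_mono r \<and> (\<forall>i\<le>n. (\<lambda>k. f (r k) i) \<longlonglongrightarrow> q i)"
proof (induction n)
  case 0
  from bounded_imp_convergent_subsequence[OF assms[of 0]]
  obtain l r where "strict_mono r" "((\<lambda>k. f k 0) \<circ> r) \<longlonglongrightarrow> l" by blast
  then show ?case by (auto simp: o_def intro!: exI[of _ r] exI[of _ "\<lambda>_. l"])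
next
  case (Suc n)
  then obtain r q where r: "strict_mono r" and q: "\<And>i. i \<le> n \<Longrightarrow> (\<lambda>k. f (r k) i) \<longlonglongrightarrow> q i" by blast
  have "bounded (range (\<lambda>k. f (r k) (Suc n)))"
    by (rule bounded_subset[OF assms[of "Suc n"]]) auto
  from bounded_imp_convergent_subsequence[OF this]
  obtain l s where s: "strict_mono s" and l: "((\<lambda>k. f (r k) (Suc n)) \<circ> s) \<longlonglongrightarrow> l" by blast
  have "(\<lambda>k. f (r (s k)) i) \<longlonglongrightarrow> (q(Suc n := l)) i" if "i \<le> Suc n" for i
    using LIMSEQ_subseq_LIMSEQ[OF q s, of i] l that by (cases "i = Suc n") (auto simp: o_def)
  moreover have "strict_mono (r \<circ> s)" using r s by (rule strict_mono_o)
  ultimately show ?case by (intro exI[of _ "r \<circ> s"] exI[of _ "q(Suc n := l)"]) (auto simp: o_def)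
qed

subsection \<open>Comparison with a static rate\<close>

context loss_system
begin

lemma performance_eq_Liminf:
  assumes "p = price \<Lambda> F P"
  shows "profit_rate C \<Lambda> \<mu> c F P \<pi> = Liminf at_top (\<lambda>R. ereal (revenue R (\<lambda>l. l * (p l - c))))"
    and "market_share C \<Lambda> \<mu> F P \<pi> = Liminf at_top (\<lambda>R. ereal (\<Sum>i<C. sales R i))"
    and "service_level C \<Lambda> \<mu> F P \<pi> = Liminf at_top (\<lambda>R. ereal (\<Sum>i<C. occupancy R i))"
  unfolding profit_rate_def market_share_def service_level_def Let_def assms[symmetric]
  using eventually_gt_at_top[of "0::real"]
  by (auto intro!: Liminf_eq elim!: eventually_mono
      simp only: profit_rate_integral market_share_integral service_level_integral)

lemma static_occupancy_limit:
  assumes \<pi>: "\<pi> = (\<lambda>_ _. l)"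
  shows "((\<lambda>R. \<Sum>i<C. occupancy R i) \<longlongrightarrow> erlang_idle C (l / \<mu>)) at_top"
proof (rule erlang_limit)
  have l: "0 \<le> l" using \<pi>_bounds[of 0 undefined] by (simp add: \<pi>)
  then show "0 \<le> l / \<mu>" using \<mu>_pos by simp
  show "\<forall>\<^sub>F R in at_top. (\<Sum>i\<le>C. occupancy R i) = 1"
    using eventually_gt_at_top[of 0] by eventually_elim (rule sum_occupancy)
  fix i assume i: "i < C"
  have rate: "\<pi> t h = l" for t h by (simp add: \<pi>)
  have sales: "sales R i = l * occupancy R i" for R
    unfolding sales_def occupancy_def by (simp only: rate mult.commute[of _ l] avg_cmult)
  have "((\<lambda>R. 1 / R / (\<mu> * Suc i)) \<longlongrightarrow> 0 / (\<mu> * Suc i)) at_top"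
    using \<mu>_pos by (intro tendsto_divide tendsto_const tendsto_divide_0[OF tendsto_const])
      (auto intro: filterlim_at_top_imp_at_infinity filterlim_ident)
  then have lim: "((\<lambda>R. 1 / R / (\<mu> * Suc i)) \<longlongrightarrow> 0) at_top" by simp
  show "((\<lambda>R. occupancy R (Suc i) - l / \<mu> / Suc i * occupancy R i) \<longlongrightarrow> 0) at_top"
  proof (rule Lim_null_comparison[OF _ lim])
    show "\<forall>\<^sub>F R in at_top. norm (occupancy R (Suc i) - l / \<mu> / Suc i * occupancy R i) \<le> 1 / R / (\<mu> * Suc i)"
      using eventually_gt_at_top[of 0]
    proof eventually_elim
      case (elim R)
      have m: "0 < \<mu> * Suc i" using \<mu>_pos by simp
      have "occupancy R (Suc i) - l / \<mu> / Suc i * occupancy R i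
          = - ((sales R i - \<mu> * Suc i * occupancy R (Suc i)) / (\<mu> * Suc i))"
        unfolding sales using \<mu>_pos by (simp add: field_simps del: of_nat_Suc)
      also have "norm \<dots> = \<bar>sales R i - \<mu> * Suc i * occupancy R (Suc i)\<bar> / (\<mu> * Suc i)"
        using m by (simp only: real_norm_def abs_minus_cancel abs_divide abs_of_pos)
      also have "\<dots> \<le> 1 / R / (\<mu> * Suc i)"
        using m by (intro divide_right_mono sales_balance elim i) simp
      finally show ?case .
    qed
  qed
qed

lemma static_performance:
  assumes p: "p = price \<Lambda> F P" and \<pi>: "\<pi> = (\<lambda>_ _. l)"
  shows "profit_rate C \<Lambda> \<mu> c F P \<pi> = ereal (l * (p l - c) * erlang_idle C (l / \<mu>))"
    and "market_share C \<Lambda> \<mu> F P \<pi> = ereal (l * erlang_idle C (l / \<mu>))"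
    and "service_level C \<Lambda> \<mu> F P \<pi> = ereal (erlang_idle C (l / \<mu>))"
proof -
  have rate: "\<pi> t h = l" for t h by (simp add: \<pi>)
  note lim = static_occupancy_limit[OF \<pi>]
  have rev: "revenue R r = r l * (\<Sum>i<C. occupancy R i)" if "0 < R" for R r
    unfolding revenue_def by (simp only: rate mult.commute[of _ "r l"] avg_cmult avg_not_full[OF that])
  have sales: "(\<Sum>i<C. sales R i) = l * (\<Sum>i<C. occupancy R i)" for R
    unfolding sales_def occupancy_def sum_distrib_left by (simp only: rate mult.commute[of _ l] avg_cmult)
  show "service_level C \<Lambda> \<mu> F P \<pi> = ereal (erlang_idle C (l / \<mu>))"
    unfolding performance_eq_Liminf(3)[OF p] using lim by (intro lim_imp_Liminf) auto
  show "market_share C \<Lambda> \<mu> F P \<pi> = ereal (l * erlang_idle C (l / \<mu>))"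
    unfolding performance_eq_Liminf(2)[OF p] sales using lim
    by (intro lim_imp_Liminf) (auto intro: tendsto_intros)
  have "profit_rate C \<Lambda> \<mu> c F P \<pi> = Liminf at_top (\<lambda>R. ereal (l * (p l - c) * (\<Sum>i<C. occupancy R i)))"
    unfolding performance_eq_Liminf(1)[OF p]
  proof (rule Liminf_eq)
    show "\<forall>\<^sub>F R in at_top. ereal (revenue R (\<lambda>l. l * (p l - c))) = ereal (l * (p l - c) * (\<Sum>i<C. occupancy R i))"
      using eventually_gt_at_top[of 0] by eventually_elim (simp only: rev)
  qed
  also have "\<dots> = ereal (l * (p l - c) * erlang_idle C (l / \<mu>))"
    using lim by (intro lim_imp_Liminf) (auto intro: tendsto_intros)
  finally show "profit_rate C \<Lambda> \<mu> c F P \<pi> = ereal (l * (p l - c) * erlang_idle C (l / \<mu>))" .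
qed

text \<open>Only the C + 1 occupancies need a subsequence: the balance up to 1/R transfers their
  convergence to the sales. The last inequality is the limit of the bound \<Lambda> on the
  rate.\<close>

lemma subsequential_occupancy:
  obtains r q where "filterlim r at_top sequentially"
    and "\<And>i. i \<le> C \<Longrightarrow> (\<lambda>k. occupancy (r k) i) \<longlonglongrightarrow> q i"
    and "\<And>i. i < C \<Longrightarrow> (\<lambda>k. sales (r k) i) \<longlonglongrightarrow> \<mu> * Suc i * q (Suc i)"
    and "\<And>i. i \<le> C \<Longrightarrow> 0 \<le> q i" and "(\<Sum>i\<le>C. q i) = 1"
    and "\<And>i. i < C \<Longrightarrow> \<mu> * Suc i * q (Suc i) \<le> \<Lambda> * q i"
proof -
  have le1: "occupancy R i \<le> 1" if "0 < R" for R i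
    unfolding occupancy_def
    using avg_mono[OF that bounded_functional_busy[of "\<lambda>b. b = i"] bounded_functional_const[of 1]] avg_const[OF that, of 1]
    by auto
  have "bounded (range (\<lambda>k. occupancy (real (Suc k)) i))" for i
    by (rule bounded_subset[of "{0..1}"]) (auto intro!: occupancy_nonneg le1 simp del: of_nat_Suc)
  from bounded_sequences_convergent_subsequence[of "\<lambda>k. occupancy (real (Suc k))", OF this, of C]
  obtain s q where s: "strict_mono s" and q: "\<And>i. i \<le> C \<Longrightarrow> (\<lambda>k. occupancy (real (Suc (s k))) i) \<longlonglongrightarrow> q i"
    by blast
  define r where "r k = real (Suc (s k))" for k
  have r0: "0 < r k" for k by (simp add: r_def)
  have r: "filterlim r at_top sequentially"
    unfolding r_def
    by (intro filterlim_compose[OF filterlim_real_sequentially] filterlim_compose[OF filterlim_Suc] filterlim_subseq s)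
  have occ: "(\<lambda>k. occupancy (r k) i) \<longlonglongrightarrow> q i" if "i \<le> C" for i
    using q[OF that] by (simp add: r_def)
  have sal: "(\<lambda>k. sales (r k) i) \<longlonglongrightarrow> \<mu> * Suc i * q (Suc i)" if "i < C" for i
  proof -
    have "(\<lambda>k. 1 / r k) \<longlonglongrightarrow> 0"
      by (intro tendsto_divide_0[OF tendsto_const] filterlim_at_top_imp_at_infinity r)
    then have "(\<lambda>k. sales (r k) i - \<mu> * Suc i * occupancy (r k) (Suc i)) \<longlonglongrightarrow> 0"
      by (rule Lim_null_comparison[rotated])
        (simp only: real_norm_def, intro always_eventually allI sales_balance r0 that)
    from tendsto_add[OF this tendsto_mult[OF tendsto_const[of "\<mu> * Suc i"] occ[of "Suc i"]]] that
    show ?thesis by simp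
  qed
  show ?thesis
  proof (rule that[OF r occ sal])
    show "0 \<le> q i" if "i \<le> C" for i
      by (rule tendsto_lowerbound[OF occ[OF that]]) (intro always_eventually allI occupancy_nonneg r0, simp)
    have "(\<lambda>k. \<Sum>i\<le>C. occupancy (r k) i) \<longlonglongrightarrow> (\<Sum>i\<le>C. q i)"
      by (intro tendsto_sum occ) auto
    then have "(\<lambda>k. 1) \<longlonglongrightarrow> (\<Sum>i\<le>C. q i)" by (simp add: sum_occupancy r0)
    then show "(\<Sum>i\<le>C. q i) = 1" by (simp add: LIMSEQ_const_iff)
    show "\<mu> * Suc i * q (Suc i) \<le> \<Lambda> * q i" if "i < C" for i
      using that by (intro LIMSEQ_le[OF sal tendsto_mult[OF tendsto_const occ]]) (auto intro: sales_bounds r0)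
  qed
qed

end

text \<open>The pair \<open>(m, a)\<close> plays the role of the market share and the service level of the given policy.
  A static rate with throughput \<open>15/19 * m\<close> does not exceed the mean rate \<open>m / a\<close>, so that it has a
  higher price; a supergradient at an interior rate bounds the profit of the given policy.\<close>

lemma static_rate_exists:
  fixes C :: nat and \<Lambda> \<mu> c :: real and q :: "nat \<Rightarrow> real" and p :: "real \<Rightarrow> real"
  defines "m \<equiv> \<Sum>i<C. \<mu> * Suc i * q (Suc i)" and "a \<equiv> \<Sum>i<C. q i"
  assumes "0 < C" "0 < \<Lambda>" "0 < \<mu>"
    and conc: "concave_on {0..\<Lambda>} (\<lambda>l. l * (p l - c))"
    and anti: "\<And>l. 0 \<le> l \<Longrightarrow> l \<le> \<Lambda> \<Longrightarrow> p l \<le> p 0"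
    and q0: "\<And>i. i \<le> C \<Longrightarrow> 0 \<le> q i" and q1: "(\<Sum>i\<le>C. q i) = 1"
    and flow: "\<And>i. i < C \<Longrightarrow> \<mu> * Suc i * q (Suc i) \<le> \<Lambda> * q i"
  obtains l k g where "0 \<le> l" "l \<le> \<Lambda>" "\<And>x. 0 \<le> x \<Longrightarrow> x \<le> \<Lambda> \<Longrightarrow> x * (p x - c) \<le> k + g * x"
    and "15 / 19 * (k * a + g * m) \<le> l * (p l - c) * erlang_idle C (l / \<mu>)"
    and "15 / 19 * m \<le> l * erlang_idle C (l / \<mu>)"
    and "15 / 19 * a \<le> erlang_idle C (l / \<mu>)"
proof -
  let ?A = "\<lambda>l. erlang_idle C (l / \<mu>)"
  have m0: "0 \<le> m" unfolding m_def using \<open>0 < \<mu>\<close> q0 by (intro sum_nonneg) auto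
  have aC: "a = 1 - q C" using q1 by (simp add: a_def lessThan_Suc_atMost[symmetric])
  then have a1: "a \<le> 1" using q0[of C] by simp
  have mle: "m \<le> \<Lambda> * a" unfolding m_def a_def sum_distrib_left by (intro sum_mono flow) simp
  have little: "m / \<mu> \<le> real C - a"
  proof -
    have "m / \<mu> = (\<Sum>i<C. real (Suc i) * q (Suc i))"
      using \<open>0 < \<mu>\<close> by (simp add: m_def sum_divide_distrib)
    also have "\<dots> = (\<Sum>i\<le>C. real i * q i)"
      by (subst sum.atMost_shift) simp
    \<comment> \<open>At most C - 1 units are occupied unless all are; this is where the service
      level enters Little's law.\<close>
    also have "\<dots> \<le> (\<Sum>i\<le>C. (real C - 1 + of_bool (i = C)) * q i)"
      using q0 by (intro sum_mono mult_right_mono) auto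
    also have "\<dots> = (real C - 1) * (\<Sum>i\<le>C. q i) + q C"
    proof -
      have "(\<Sum>i\<le>C. of_bool (i = C) * q i) = q C" by (simp add: lessThan_Suc_atMost[symmetric])
      then show ?thesis by (simp only: distrib_right sum.distrib sum_distrib_left)
    qed
    finally show ?thesis by (simp add: q1 aC)
  qed
  show ?thesis
  proof (cases "m = 0")
    case True
    show ?thesis
    \<comment> \<open>Without sales the rate 0 suffices. As \<open>p 0\<close> is the highest price,
      the line through the origin with slope \<open>p 0 - c\<close> is a majorant.\<close>
    proof (rule that[of 0 0 "p 0 - c"])
      show "x * (p x - c) \<le> 0 + (p 0 - c) * x" if "0 \<le> x" "x \<le> \<Lambda>" for x
        using anti[OF that] that mult_left_mono[of "p x - c" "p 0 - c" x] by (simp add: mult.commute)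
      have "erlang_idle C 0 = 1"
      proof -
        obtain n where "C = Suc n" using \<open>0 < C\<close> by (cases C) auto
        moreover have "(\<Sum>k\<le>j. 0 ^ k / fact k :: real) = 1" for j
          by (subst sum.atMost_shift) simp
        ultimately show ?thesis
          unfolding erlang_idle_def by (simp add: lessThan_Suc_atMost del: power_0_left)
      qed
      then show "15 / 19 * a \<le> ?A 0" using a1 by simp
    qed (use True \<open>0 < \<Lambda>\<close> in auto)
  next
    case False
    with m0 have m: "0 < m" by simp
    with mle \<open>0 < \<Lambda>\<close> have a: "0 < a" by (metis less_le_trans zero_less_mult_pos)
    \<comment> \<open>The mean rate of the policy over the times with an idle unit;
      \<open>x0 / \<mu>\<close> is the corresponding load.\<close>
    define x0 where "x0 = m / a"
    have x0: "0 < x0" "x0 \<le> \<Lambda>" using m a mle by (auto simp: x0_def divide_le_eq)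
    have Ax0: "15 / 19 * a \<le> ?A x0"
    proof (rule erlang_idle_lower_bound)
      have "a * (1 + x0 / \<mu>) = a + m / \<mu>" using a by (simp add: x0_def distrib_left)
      then show "a * (1 + x0 / \<mu>) \<le> real C" using little by simp
    qed (use \<open>0 < C\<close> x0 \<open>0 < \<mu>\<close> a1 in auto)
    have "continuous_on {0..x0} (\<lambda>l. l * ?A l)"
      using \<open>0 < \<mu>\<close>
      by (intro continuous_intros continuous_on_compose2[OF continuous_on_erlang_idle]) auto
    moreover have "15 / 19 * m \<le> x0 * ?A x0"
      using mult_left_mono[OF Ax0, of x0] x0(1) a by (simp add: x0_def)
    \<comment> \<open>The static throughput vanishes at rate 0 and is at least 15/19 m at
      \<open>x0\<close>, so it takes this value in between.\<close>
    ultimately obtain l where l: "0 \<le> l" "l \<le> x0" and thr: "l * ?A l = 15 / 19 * m"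
      using IVT'[of "\<lambda>l. l * ?A l" 0 "15 / 19 * m" x0] m x0 by auto
    have "l \<noteq> 0" using thr m by auto
    with l have l0: "0 < l" by simp
    have Al: "15 / 19 * a \<le> ?A l"
      using Ax0 erlang_idle_antimono[of "l / \<mu>" "x0 / \<mu>" C] l \<open>0 < \<mu>\<close> by (simp add: divide_right_mono)
    \<comment> \<open>The supergradient below needs an interior rate. If l were \<Lambda>, the mean
      rate would be maximal, the flow inequalities would be equalities, and Erlang's formula would
      give the static rate the full throughput m instead of 15/19 m.\<close>
    have "l \<noteq> \<Lambda>"
    proof
      assume "l = \<Lambda>"
      with l x0 have "m = \<Lambda> * a" using a by (simp add: x0_def field_simps)
      then have "(\<Sum>i<C. \<Lambda> * q i - \<mu> * Suc i * q (Suc i)) = 0"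
        by (simp add: m_def a_def sum_subtractf sum_distrib_left)
      then have eq: "\<Lambda> * q i = \<mu> * Suc i * q (Suc i)" if "i < C" for i
        using that flow by (subst (asm) sum_nonneg_eq_0_iff) auto
      have "((\<lambda>_::nat. \<Sum>i<C. q i) \<longlongrightarrow> erlang_idle C (\<Lambda> / \<mu>)) sequentially"
      proof (rule erlang_limit)
        fix i assume "i < C"
        have "q (Suc i) - \<Lambda> / \<mu> / Suc i * q i = q (Suc i) - (\<Lambda> * q i) / (\<mu> * Suc i)" by simp
        also have "\<dots> = 0" unfolding eq[OF \<open>i < C\<close>] using \<open>0 < \<mu>\<close> by simp
        finally show "((\<lambda>_. q (Suc i) - \<Lambda> / \<mu> / Suc i * q i) \<longlongrightarrow> 0) sequentially" by simp
      qed (use q1 \<open>0 < \<Lambda>\<close> \<open>0 < \<mu>\<close> in auto)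
      then have "a = ?A \<Lambda>" by (simp add: a_def LIMSEQ_const_iff)
      with thr \<open>l = \<Lambda>\<close> \<open>m = \<Lambda> * a\<close> \<open>0 < \<Lambda>\<close> a show False by simp
    qed
    with l x0 have l\<Lambda>: "l < \<Lambda>" by simp
    define f where "f x = - (x * (p x - c))" for x
    have "convex_on {0..\<Lambda>} f" using conc unfolding concave_on_def f_def[abs_def] .
    moreover have "l \<in> interior {0..\<Lambda>}" using l0 l\<Lambda> by (simp add: interior_atLeastAtMost_real)
    ultimately obtain d where d: "\<And>x. x \<in> {0..\<Lambda>} \<Longrightarrow> f l + d * (x - l) \<le> f x"
      using convex_le_Inf_differential by blast
    define g where "g = - d"
    have g: "x * (p x - c) \<le> l * (p l - c) - g * l + g * x" if "0 \<le> x" "x \<le> \<Lambda>" for x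
      using d[of x] that by (simp add: f_def g_def algebra_simps)
    \<comment> \<open>The majorant evaluated at rate 0, where the profit is 0: its slope is at most
      the margin at l.\<close>
    have "g * l \<le> (p l - c) * l" using g[of 0] \<open>0 < \<Lambda>\<close> by (simp add: mult.commute)
    then have gle: "g \<le> p l - c" using l0 by simp
    have "a * l \<le> m" using l(2) a by (simp add: x0_def field_simps)
    \<comment> \<open>Rewritten so that the excess over l, \<open>m - a * l\<close>, is valued at
      the slope g, which is at most the margin. Hence the policy earns at most the margin at l per
      sale.\<close>
    have "(l * (p l - c) - g * l) * a + g * m = m * (p l - c) - (m - a * l) * (p l - c - g)"
      by (simp add: algebra_simps)
    also have "\<dots> \<le> m * (p l - c)"
      using gle \<open>a * l \<le> m\<close> by simp
    finally have bound: "(l * (p l - c) - g * l) * a + g * m \<le> m * (p l - c)" .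
    show ?thesis
    proof (rule that[of l "l * (p l - c) - g * l" g])
      have "15 / 19 * ((l * (p l - c) - g * l) * a + g * m) \<le> 15 / 19 * m * (p l - c)"
        using bound by simp
      also have "\<dots> = l * (p l - c) * ?A l"
        unfolding thr[symmetric] by (simp only: mult_ac)
      finally show "15 / 19 * ((l * (p l - c) - g * l) * a + g * m) \<le> l * (p l - c) * ?A l" .
    qed (use l l\<Lambda> g thr Al in auto)
  qed
qed

lemma ereal_ratio_ge:
  fixes x y :: ereal
  assumes "ereal k * y \<le> ereal u" "0 < y" "y \<le> ereal v"
  shows "ereal k \<le> ereal u / y"
proof -
  obtain b where "y = ereal b" using assms(2,3) by (cases y) auto
  with assms show ?thesis by (simp add: pos_le_divide_eq)
qed

text \<open>The three products also cover a measure of the optimal policy that is zero or, for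
  profit, negative; the quotients are compared when all denominators are positive.\<close>

theorem theorem1:
  fixes C :: nat and \<Lambda> \<mu> c \<alpha>1 \<alpha>2 \<alpha>3 :: real and F :: "real measure" and P :: "real set"
    and \<pi>opt :: policy
  assumes "C > 0" and "\<Lambda> > 0" and "\<mu> > 0" and "c > 0"
    and "real_distribution F"
    and "bij_betw (effective_rate \<Lambda> F) P {0..\<Lambda>}"
    and "concave_on {0..\<Lambda>} (\<lambda>l. l * (price \<Lambda> F P l - c))"
    and "\<alpha>1 \<ge> 0" and "\<alpha>2 \<ge> 0" and "\<alpha>3 \<ge> 0" and "\<alpha>1 + \<alpha>2 + \<alpha>3 = 1"
    and "optimal_policy C \<Lambda> \<mu> c F P \<alpha>1 \<alpha>2 \<alpha>3 \<pi>opt"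
  shows "\<exists>\<pi>s. static_policy \<Lambda> \<pi>s \<and>
    (let R = profit_rate C \<Lambda> \<mu> c F P; M = market_share C \<Lambda> \<mu> F P; A = service_level C \<Lambda> \<mu> F P in
      (R \<pi>opt > 0 \<and> M \<pi>opt > 0 \<and> A \<pi>opt > 0 \<longrightarrow>
        Min {R \<pi>s / R \<pi>opt, M \<pi>s / M \<pi>opt, A \<pi>s / A \<pi>opt} \<ge> ereal (15 / 19)) \<and>
      R \<pi>s \<ge> ereal (15 / 19) * R \<pi>opt \<and>
      M \<pi>s \<ge> ereal (15 / 19) * M \<pi>opt \<and>
      A \<pi>s \<ge> ereal (15 / 19) * A \<pi>opt)"
proof -
  define p where "p = price \<Lambda> F P"
  have dem: "\<Lambda> * measure F {p l<..} = l" if "0 \<le> l" "l \<le> \<Lambda>" for l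
    using f_the_inv_into_f_bij_betw[OF assms(6), of l] that
    by (simp add: p_def price_def effective_rate_def)
  have "admissible \<Lambda> \<pi>opt" using assms(12) by (simp add: optimal_policy_def)
  with assms(2,3,5) dem interpret loss_system C \<Lambda> \<mu> F p \<pi>opt
    by (intro loss_system.intro)
  obtain r q where r: "filterlim r at_top sequentially"
    and occ: "\<And>i. i \<le> C \<Longrightarrow> (\<lambda>k. occupancy (r k) i) \<longlonglongrightarrow> q i"
    and sal: "\<And>i. i < C \<Longrightarrow> (\<lambda>k. sales (r k) i) \<longlonglongrightarrow> \<mu> * Suc i * q (Suc i)"
    and q: "\<And>i. i \<le> C \<Longrightarrow> 0 \<le> q i" "(\<Sum>i\<le>C. q i) = 1" "\<And>i. i < C \<Longrightarrow> \<mu> * Suc i * q (Suc i) \<le> \<Lambda> * q i"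
    by (rule subsequential_occupancy) blast
  define m where "m = (\<Sum>i<C. \<mu> * Suc i * q (Suc i))"
  define a where "a = (\<Sum>i<C. q i)"
  have conc: "concave_on {0..\<Lambda>} (\<lambda>l. l * (p l - c))" using assms(7) by (simp add: p_def)
  have anti: "p l \<le> p 0" if "0 \<le> l" "l \<le> \<Lambda>" for l
    using that by (intro price_antimono) auto
  obtain l k g where l: "0 \<le> l" "l \<le> \<Lambda>"
    and aff: "\<And>x. 0 \<le> x \<Longrightarrow> x \<le> \<Lambda> \<Longrightarrow> x * (p x - c) \<le> k + g * x"
    and Rs: "15 / 19 * (k * a + g * m) \<le> l * (p l - c) * erlang_idle C (l / \<mu>)"
    and Ms: "15 / 19 * m \<le> l * erlang_idle C (l / \<mu>)"
    and As: "15 / 19 * a \<le> erlang_idle C (l / \<mu>)"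
    unfolding m_def a_def
    by (rule static_rate_exists[OF assms(1-3) conc anti q]) blast+
  have lim_occ: "(\<lambda>k. \<Sum>i<C. occupancy (r k) i) \<longlonglongrightarrow> a"
    unfolding a_def by (intro tendsto_sum occ) auto
  have lim_sal: "(\<lambda>k. \<Sum>i<C. sales (r k) i) \<longlonglongrightarrow> m"
    unfolding m_def by (intro tendsto_sum sal) auto
  have A: "service_level C \<Lambda> \<mu> F P \<pi>opt \<le> ereal a"
    unfolding performance_eq_Liminf(3)[OF p_def]
    by (rule Liminf_le_subsequential_limit[OF r _ tendsto_ereal[OF lim_occ]]) auto
  have M: "market_share C \<Lambda> \<mu> F P \<pi>opt \<le> ereal m"
    unfolding performance_eq_Liminf(2)[OF p_def]
    by (rule Liminf_le_subsequential_limit[OF r _ tendsto_ereal[OF lim_sal]]) auto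
  have R: "profit_rate C \<Lambda> \<mu> c F P \<pi>opt \<le> ereal (k * a + g * m)"
    unfolding performance_eq_Liminf(1)[OF p_def]
  proof (rule Liminf_le_subsequential_limit[OF r])
    \<comment> \<open>The affine bound holds at every positive horizon, so only its right-hand side
      has to converge along r.\<close>
    show "\<forall>\<^sub>F T in at_top. ereal (revenue T (\<lambda>l. l * (p l - c)))
        \<le> ereal (k * (\<Sum>i<C. occupancy T i) + g * (\<Sum>i<C. sales T i))"
      using eventually_gt_at_top[of 0] by eventually_elim (simp only: ereal_less_eq, intro revenue_le_affine aff)
    show "(\<lambda>j. ereal (k * (\<Sum>i<C. occupancy (r j) i) + g * (\<Sum>i<C. sales (r j) i))) \<longlonglongrightarrow> ereal (k * a + g * m)"
      by (intro tendsto_intros lim_occ lim_sal)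
  qed simp
  define \<pi>s :: policy where "\<pi>s = (\<lambda>t h. l)"
  have st: "static_policy \<Lambda> \<pi>s"
    using l by (auto simp: static_policy_def \<pi>s_def)
  interpret S: loss_system C \<Lambda> \<mu> F p \<pi>s
    unfolding \<pi>s_def by (rule static_loss_system[OF l])
  note S = S.static_performance[OF p_def \<pi>s_def]
  have scale: "ereal (15 / 19) * x \<le> ereal u" if "x \<le> ereal v" "15 / 19 * v \<le> u" for x u v
  proof -
    have "ereal (15 / 19) * x \<le> ereal (15 / 19) * ereal v"
      using that(1) by (rule ereal_mult_left_mono) simp
    also have "\<dots> \<le> ereal u" using that(2) by simp
    finally show ?thesis .
  qed
  note bounds = scale[OF R Rs] scale[OF M Ms] scale[OF A As]
  show ?thesis
    unfolding Let_def
  proof (intro exI[of _ \<pi>s] conjI impI st)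
    show "ereal (15 / 19) * profit_rate C \<Lambda> \<mu> c F P \<pi>opt \<le> profit_rate C \<Lambda> \<mu> c F P \<pi>s"
      "ereal (15 / 19) * market_share C \<Lambda> \<mu> F P \<pi>opt \<le> market_share C \<Lambda> \<mu> F P \<pi>s"
      "ereal (15 / 19) * service_level C \<Lambda> \<mu> F P \<pi>opt \<le> service_level C \<Lambda> \<mu> F P \<pi>s"
      unfolding S by (rule bounds)+
    assume "0 < profit_rate C \<Lambda> \<mu> c F P \<pi>opt \<and> 0 < market_share C \<Lambda> \<mu> F P \<pi>opt \<and> 0 < service_level C \<Lambda> \<mu> F P \<pi>opt"
    then show "ereal (15 / 19) \<le> Min {profit_rate C \<Lambda> \<mu> c F P \<pi>s / profit_rate C \<Lambda> \<mu> c F P \<pi>opt,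
        market_share C \<Lambda> \<mu> F P \<pi>s / market_share C \<Lambda> \<mu> F P \<pi>opt,
        service_level C \<Lambda> \<mu> F P \<pi>s / service_level C \<Lambda> \<mu> F P \<pi>opt}"
      unfolding S using ereal_ratio_ge[OF bounds(1) _ R] ereal_ratio_ge[OF bounds(2) _ M] ereal_ratio_ge[OF bounds(3) _ A]
      by (subst Min_ge_iff) blast+
  qed
qed

end
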